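(* Let $\mathcal R$ be any encoding system and $\mathcal C$ any complexity measure. Then for all $c\in\mathbb N$, $$N^{\mathcal R}_{\mathcal A_{\mathrm{mci}}}(c)\;=\;\min_{\mathcal A} N^{\mathcal R}_{\mathcal A}(c)\;=\;N(\mathcal F^{\mathcal R}_c),$$ where the minimum is over all learning algorithms $\mathcal A$ and $\mathcal A_{\mathrm{mci}}$ is the Minimum-Complexity Interpolator for $\mathcal R,\mathcal C$. As a consequence (for $\mathcal C$ satisfying Assumption (E) of the context), the following three statements are equivalent: (i) $\mathcal F^{\mathcal R}$ admits non-asymptotic length generalization (w.r.t. $\mathcal R$ and $\mathcal C$); (ii) $\mathcal F^{\mathcal R}$ admits non-asymptotic length generalization via the learning algorithm $\mathcal A_{\mathrm{mci}}$; (iii) the length complexity $N(\mathcal F^{\mathcal R}_c)$ is computably bounded in $c$.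
   Context: Strings are over $\{0,1\}$; $\{0,1\}^*$ contains the empty string. Encoding system: a Turing machine $\mathcal R$ which, on input any string $p\in\{0,1\}^*$, outputs the description of a Turing machine computing a total function $\{0,1\}^*\to\{0,1\}$; this function is denoted $\mathcal R(p)$. Put $\mathcal F^{\mathcal R}=\{\mathcal R(p):p\in\{0,1\}^*\}$. Complexity measure: a map $\mathcal C:\{0,1\}^*\to\mathbb N$. For $f\in\mathcal F^{\mathcal R}$, $\mathcal C^{\mathcal R}(f)=\min\{\mathcal C(p):\mathcal R(p)=f\}$, and $\mathcal F^{\mathcal R}_c=\{f\in\mathcal F^{\mathcal R}:\mathcal C^{\mathcal R}(f)\le c\}$. Assumption (E): $\mathcal C$ is computable; there is a Turing machine $E$ enumerating all of $\{0,1\}^*$ in non-decreasing order of $\mathcal C$ (range of $E$ is $\{0,1\}^*$, and $i\le i'$ implies $\mathcal C(E(i))\le\mathcal C(E(i'))$); and for each $c\in\mathbb N$ the set $\{p:\mathcal C(p)\le c\}$ is finite. Training data: $D_N(f)=\{(x,f(x)):x\in\{0,1\}^*,|x|\le N\}$. A learning algorithm is a Turing machine $\mathcal A$ that takes a training set $D_N(f)$ and outputs a string. Length complexity of an algorithm: $N^{\mathcal R}_{\mathcal A}(f)=\min\{N\ge 0:\forall n\ge N,\ \mathcal R(\mathcal A(D_n(f)))=f\}$ ($\infty$ if no such $N$), and $N^{\mathcal R}_{\mathcal A}(c)=\max\{N^{\mathcal R}_{\mathcal A}(f): f\in\mathcal F^{\mathcal R},\ \mathcal C^{\mathcal R}(f)\le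 c\}$ (possibly $\infty$; $0$ if there is no such $f$). Length complexity of a class $\mathcal F$: $N(\mathcal F)=\min\{n\in\mathbb N:\forall f\ne f'\in\mathcal F,\ \exists x\in\{0,1\}^*,|x|\le n,\ f(x)\ne f'(x)\}$ ($\infty$ if no such $n$). Minimum-Complexity Interpolator $\mathcal A_{\mathrm{mci}}$: on input a finite dataset, outputs a string $p$ minimizing $\mathcal C(p)$ among all $p$ with $\mathcal R(p)(x)=y$ for all $(x,y)$ in the dataset (ties broken by any fixed rule; under Assumption (E) it is implemented by enumerating strings with $E$ and returning the first consistent one). Non-asymptotic length generalization of $\mathcal F^{\mathcal R}$ w.r.t. $\mathcal R,\mathcal C$ (via $\mathcal A$): there exist a learning algorithm $\mathcal A$ (resp. for this $\mathcal A$) and a computable $\hat N:\mathbb N\to\mathbb N$ such that for all $f\in\mathcal F^{\mathcal R}$ and all $N'\ge\hat N(\mathcal C^{\mathcal R}(f))$, $\mathcal R(\mathcal A(D_{N'}(f)))=f$. A function $g:\mathbb N\to\mathbb N\cup\{\infty\}$ is computably bounded if there is a total computable $h:\mathbb N\to\mathbb N$ with $g(n)\le h(n)$ for all $n$. *)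

theory Defs
  imports "HOL-Library.Extended_Nat"
begin

type_synonym bits = "bool list"

section \<open>Turing machines\<close>

text \<open>
  Deterministic one-tape machines with a two-way infinite tape.  States and tape symbols are
  natural numbers; symbol 0 is the blank, 1 and 2 are the input/output symbols for the bits 0
  and 1, and all further symbols are work symbols.  A machine is a finite transition table
  (state, read symbol) |-> (next state, written symbol, move); if several entries have the same
  key, the first one counts.  The initial state is 0, and a machine halts as soon as no entry of
  the table applies.
\<close>

datatype move = MLeft | MStay | MRight

type_synonym tm = "((nat \<times> nat) \<times> (nat \<times> nat \<times> move)) list"

text \<open>
  A configuration (q, ls, rs) has state q.  The list rs holds the scanned cell followed by the
  cells to its right, ls the cells to the left of the head (nearest first); every cell beyond
  the ends of the lists is blank.
\<close>

type_synonym config = "nat \<times> nat list \<times> nat list"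

fun head_symbol :: "nat list \<Rightarrow> nat" where
  "head_symbol [] = 0"
| "head_symbol (a # rs) = a"

fun act :: "move \<Rightarrow> nat \<Rightarrow> nat list \<Rightarrow> nat list \<Rightarrow> nat list \<times> nat list" where
  "act MLeft b ls rs = (tl ls, head_symbol ls # b # tl rs)"
| "act MStay b ls rs = (ls, b # tl rs)"
| "act MRight b ls rs = (b # ls, tl rs)"

fun tm_step :: "tm \<Rightarrow> config \<Rightarrow> config option" where
  "tm_step M (q, ls, rs) =
     (case map_of M (q, head_symbol rs) of
        None \<Rightarrow> None
      | Some (q', b, d) \<Rightarrow> Some (q', act d b ls rs))"

definition bit_symbol :: "bool \<Rightarrow> nat" where
  "bit_symbol b = (if b then 2 else 1)"

definition initial_config :: "bits \<Rightarrow> config" where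
  "initial_config x = (0, [], map bit_symbol x)"

text \<open>The output is the maximal block of bits that starts at the scanned cell.\<close>

fun tm_output :: "config \<Rightarrow> bits" where
  "tm_output (q, ls, rs) = map (\<lambda>a. a = 2) (takeWhile (\<lambda>a. a = 1 \<or> a = 2) rs)"

definition tm_computes :: "tm \<Rightarrow> bits \<Rightarrow> bits \<Rightarrow> bool" where
  "tm_computes M x y \<longleftrightarrow>
     (\<exists>cf. (\<lambda>c c'. tm_step M c = Some c')\<^sup>*\<^sup>* (initial_config x) cf
         \<and> tm_step M cf = None \<and> tm_output cf = y)"

text \<open>
  Numbers are presented to machines in unary; for the notions below (which only concern
  computability) this is interchangeable with binary.
\<close>

definition unary :: "nat \<Rightarrow> bits" where
  "unary n = replicate n True"

definition computable_nat_fun :: "(nat \<Rightarrow> nat) \<Rightarrow> bool" where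
  "computable_nat_fun h \<longleftrightarrow> (\<exists>M. \<forall>n. tm_computes M (unary n) (unary (h n)))"

text \<open>
  The description of a machine: the rows of the table are flattened to a list of numbers, each
  of which is written in unary and terminated by a 0.
\<close>

fun move_code :: "move \<Rightarrow> nat" where
  "move_code MLeft = 0"
| "move_code MStay = 1"
| "move_code MRight = 2"

fun row_code :: "(nat \<times> nat) \<times> (nat \<times> nat \<times> move) \<Rightarrow> nat list" where
  "row_code ((q, a), (q', b, d)) = [q, a, q', b, move_code d]"

definition tm_description :: "tm \<Rightarrow> bits" where
  "tm_description M = concat (map (\<lambda>n. unary n @ [False]) (concat (map row_code M)))"

section \<open>Encoding systems and complexity measures\<close>

definition tm_computes_fun :: "tm \<Rightarrow> (bits \<Rightarrow> bool) \<Rightarrow> bool" where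
  "tm_computes_fun M f \<longleftrightarrow> (\<forall>x. tm_computes M x [f x])"

definition encoding_system :: "tm \<Rightarrow> bool" where
  "encoding_system R \<longleftrightarrow>
     (\<forall>p. \<exists>M f. tm_computes R p (tm_description M) \<and> tm_computes_fun M f)"

definition encodes :: "tm \<Rightarrow> bits \<Rightarrow> (bits \<Rightarrow> bool) \<Rightarrow> bool" where
  "encodes R p f \<longleftrightarrow> (\<exists>M. tm_computes R p (tm_description M) \<and> tm_computes_fun M f)"

text \<open>
  The function R(p).  For an encoding system it exists and is unique, see the lemma
  \<open>decode_eq_iff\<close> below.
\<close>

definition decode :: "tm \<Rightarrow> bits \<Rightarrow> (bits \<Rightarrow> bool)" where
  "decode R p = (THE f. encodes R p f)"

definition fun_class :: "tm \<Rightarrow> (bits \<Rightarrow> bool) set" where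
  "fun_class R = range (decode R)"

definition complexity :: "tm \<Rightarrow> (bits \<Rightarrow> nat) \<Rightarrow> (bits \<Rightarrow> bool) \<Rightarrow> nat" where
  "complexity R C f = Inf {C p | p. decode R p = f}"

definition fun_class_le :: "tm \<Rightarrow> (bits \<Rightarrow> nat) \<Rightarrow> nat \<Rightarrow> (bits \<Rightarrow> bool) set" where
  "fun_class_le R C c = {f \<in> fun_class R. complexity R C f \<le> c}"

definition assumption_E :: "(bits \<Rightarrow> nat) \<Rightarrow> (nat \<Rightarrow> bits) \<Rightarrow> bool" where
  "assumption_E C E \<longleftrightarrow>
     (\<exists>M. \<forall>p. tm_computes M p (unary (C p))) \<and>
     (\<exists>M. \<forall>i. tm_computes M (unary i) (E i)) \<and>
     range E = UNIV \<and>
     (\<forall>i i'. i \<le> i' \<longrightarrow> C (E i) \<le> C (E i')) \<and>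
     (\<forall>c. finite {p. C p \<le> c})"

section \<open>Training data and learning algorithms\<close>

type_synonym dataset = "(bits \<times> bool) set"

definition training_data :: "nat \<Rightarrow> (bits \<Rightarrow> bool) \<Rightarrow> dataset" where
  "training_data N f = {(x, f x) | x. length x \<le> N}"

text \<open>
  A machine receives a finite dataset as the list of its examples (x,y) in the
  length-lexicographic order of xy.  The position of a string in this order is the number
  whose binary representation is the string prefixed by 1.  In the code of an example every bit
  of x is preceded by 1, and the label is preceded by 0.
\<close>

definition bits_rank :: "bits \<Rightarrow> nat" where
  "bits_rank x = foldl (\<lambda>n b. 2 * n + of_bool b) 1 x"

definition example_rank :: "bits \<times> bool \<Rightarrow> nat" where
  "example_rank e = bits_rank (fst e @ [snd e])"

definition example_code :: "bits \<times> bool \<Rightarrow> bits" where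
  "example_code e = concat (map (\<lambda>b. [True, b]) (fst e)) @ [False, snd e]"

definition dataset_code :: "dataset \<Rightarrow> bits" where
  "dataset_code D = concat (map example_code (sorted_key_list_of_set example_rank D))"

text \<open>
  A learning algorithm is identified with the map from datasets to strings that it computes.
  The machine has to halt on the training sets of the functions in the class; nothing is
  required of it on other inputs (for instance, the search performed by the interpolator below
  does not terminate on a dataset that no string fits).
\<close>

definition learning_algorithm :: "tm \<Rightarrow> (dataset \<Rightarrow> bits) \<Rightarrow> bool" where
  "learning_algorithm R A \<longleftrightarrow>
     (\<exists>M. \<forall>f\<in>fun_class R. \<forall>N.
        tm_computes M (dataset_code (training_data N f)) (A (training_data N f)))"

definition consistent :: "tm \<Rightarrow> bits \<Rightarrow> dataset \<Rightarrow> bool" where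
  "consistent R p D \<longleftrightarrow> (\<forall>(x, y)\<in>D. decode R p x = y)"

definition is_mci :: "tm \<Rightarrow> (bits \<Rightarrow> nat) \<Rightarrow> (dataset \<Rightarrow> bits) \<Rightarrow> bool" where
  "is_mci R C A \<longleftrightarrow>
     (\<forall>D. finite D \<and> (\<exists>p. consistent R p D) \<longrightarrow> is_arg_min C (\<lambda>p. consistent R p D) (A D))"

definition mci_enum :: "tm \<Rightarrow> (nat \<Rightarrow> bits) \<Rightarrow> dataset \<Rightarrow> bits" where
  "mci_enum R E D = E (LEAST i. consistent R (E i) D)"

section \<open>Length complexity and length generalization\<close>

text \<open>In \<^typ>\<open>enat\<close> the infimum of the empty set is \<open>\<infinity>\<close> and its supremum is 0.\<close>

definition alg_length_complexity ::
    "tm \<Rightarrow> (dataset \<Rightarrow> bits) \<Rightarrow> (bits \<Rightarrow> bool) \<Rightarrow> enat" where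
  "alg_length_complexity R A f =
     Inf (enat ` {N. \<forall>n\<ge>N. decode R (A (training_data n f)) = f})"

text \<open>
  The supremum of a nonempty set of values in \<^typ>\<open>enat\<close> is \<open>\<infinity>\<close> or attained.
\<close>

definition alg_length_complexity_le ::
    "tm \<Rightarrow> (bits \<Rightarrow> nat) \<Rightarrow> (dataset \<Rightarrow> bits) \<Rightarrow> nat \<Rightarrow> enat" where
  "alg_length_complexity_le R C A c =
     Sup (alg_length_complexity R A ` fun_class_le R C c)"

definition class_length_complexity :: "(bits \<Rightarrow> bool) set \<Rightarrow> enat" where
  "class_length_complexity F =
     Inf (enat ` {n. \<forall>f\<in>F. \<forall>f'\<in>F. f \<noteq> f' \<longrightarrow> (\<exists>x. length x \<le> n \<and> f x \<noteq> f' x)})"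

definition length_generalization_via ::
    "tm \<Rightarrow> (bits \<Rightarrow> nat) \<Rightarrow> (dataset \<Rightarrow> bits) \<Rightarrow> bool" where
  "length_generalization_via R C A \<longleftrightarrow>
     learning_algorithm R A \<and>
     (\<exists>Nhat. computable_nat_fun Nhat \<and>
        (\<forall>f\<in>fun_class R. \<forall>N'\<ge>Nhat (complexity R C f). decode R (A (training_data N' f)) = f))"

definition length_generalization :: "tm \<Rightarrow> (bits \<Rightarrow> nat) \<Rightarrow> bool" where
  "length_generalization R C \<longleftrightarrow> (\<exists>A. length_generalization_via R C A)"

definition computably_bounded :: "(nat \<Rightarrow> enat) \<Rightarrow> bool" where
  "computably_bounded g \<longleftrightarrow> (\<exists>h. computable_nat_fun h \<and> (\<forall>n. g n \<le> enat (h n)))"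

section \<open>Well-definedness\<close>

lemma tm_computes_unique:
  assumes "tm_computes M x y" "tm_computes M x y'"
  shows "y = y'"
proof -
  let ?r = "\<lambda>c c'. tm_step M c = Some c'"
  obtain c where c: "?r\<^sup>*\<^sup>* (initial_config x) c" "tm_step M c = None" "tm_output c = y"
    using assms(1) unfolding tm_computes_def by blast
  obtain c' where c': "?r\<^sup>*\<^sup>* (initial_config x) c'" "tm_step M c' = None" "tm_output c' = y'"
    using assms(2) unfolding tm_computes_def by blast
  have *: "?r\<^sup>*\<^sup>* a c \<Longrightarrow> ?r\<^sup>*\<^sup>* a c' \<Longrightarrow> c = c'" for a
  proof (induction rule: converse_rtranclp_induct)
    case base
    then show ?case using c(2) by (auto elim: converse_rtranclpE)
  next
    case (step a b)
    from step.prems show ?case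
    proof (cases rule: converse_rtranclpE)
      case base
      then show ?thesis using step.hyps(1) c'(2) by simp
    next
      case (step b')
      then show ?thesis using \<open>tm_step M a = Some b\<close> \<open>?r\<^sup>*\<^sup>* b c' \<Longrightarrow> c = c'\<close> by auto
    qed
  qed
  then show ?thesis using c c' by blast
qed

lemma unary_append_eq:
  "unary m @ False # u = unary n @ False # v \<longleftrightarrow> m = n \<and> u = v"
  unfolding unary_def
proof (induction m arbitrary: n)
  case 0
  then show ?case by (cases n) auto
next
  case (Suc m)
  then show ?case by (cases n) auto
qed

lemma inj_tm_description: "inj tm_description"
proof -
  have inj_nums: "ms = ns"
    if "concat (map (\<lambda>n. unary n @ [False]) ms) = concat (map (\<lambda>n. unary n @ [False]) ns)"
    for ms ns
    using that
  proof (induction ms arbitrary: ns)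
    case Nil
    then show ?case by (cases ns) auto
  next
    case (Cons m ms)
    then show ?case by (cases ns) (auto simp: unary_append_eq)
  qed
  have inj_move: "d = d'" if "move_code d = move_code d'" for d d'
    using that by (cases d; cases d') auto
  have inj_rows: "M = M'" if "concat (map row_code M) = concat (map row_code M')" for M M'
    using that
  proof (induction M arbitrary: M')
    case Nil
    then show ?case by (cases M' rule: list.exhaust) auto
  next
    case (Cons r M)
    then show ?case by (cases r rule: row_code.cases; cases M') (auto dest: inj_move)
  qed
  show ?thesis
    unfolding inj_def tm_description_def using inj_nums inj_rows by blast
qed

lemma encodes_unique:
  assumes "encodes R p f" "encodes R p f'"
  shows "f = f'"
proof -
  obtain M where M: "tm_computes R p (tm_description M)" "tm_computes_fun M f"
    using assms(1) unfolding encodes_def by blast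
  obtain M' where M': "tm_computes R p (tm_description M')" "tm_computes_fun M' f'"
    using assms(2) unfolding encodes_def by blast
  have "M = M'"
    using tm_computes_unique[OF M(1) M'(1)] inj_tm_description by (simp add: inj_eq)
  then show ?thesis
    using M(2) M'(2) tm_computes_unique unfolding tm_computes_fun_def by blast
qed

lemma decode_eq_iff:
  assumes "encoding_system R"
  shows "decode R p = f \<longleftrightarrow> encodes R p f"
proof -
  obtain g where g: "encodes R p g"
    using assms unfolding encoding_system_def encodes_def by blast
  then have "decode R p = g"
    unfolding decode_def using encodes_unique by blast
  then show ?thesis using g encodes_unique by blast
qed

lemma inj_bits_rank: "inj bits_rank"
proof -
  have snoc: "bits_rank (x @ [b]) = 2 * bits_rank x + of_bool b" for x b
    by (simp add: bits_rank_def)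
  have pos: "bits_rank x > 0" for x
    by (induction x rule: rev_induct) (simp_all add: snoc, simp add: bits_rank_def)
  have "bits_rank x = bits_rank y \<Longrightarrow> x = y" for x y
  proof (induction x arbitrary: y rule: rev_induct)
    case Nil
    then show ?case
    proof (cases y rule: rev_cases)
      case (snoc y' b)
      then show ?thesis
        using Nil pos[of y'] \<open>\<And>x b. bits_rank (x @ [b]) = 2 * bits_rank x + of_bool b\<close>[of y' b]
        by (simp add: bits_rank_def)
    qed simp
  next
    case (snoc b x)
    show ?case
    proof (cases y rule: rev_cases)
      case Nil
      then show ?thesis
        using snoc.prems pos[of x] \<open>\<And>x b. bits_rank (x @ [b]) = 2 * bits_rank x + of_bool b\<close>[of x b]
        by (simp add: bits_rank_def)
    next
      case (snoc y' b')
      have eq: "2 * bits_rank x + of_bool b = 2 * bits_rank y' + of_bool b'"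
        using snoc.prems snoc \<open>\<And>x b. bits_rank (x @ [b]) = 2 * bits_rank x + of_bool b\<close> by simp
      then have "b = b'" by (cases b; cases b') (simp_all, presburger+)
      then show ?thesis using eq snoc snoc.IH by simp
    qed
  qed
  then show ?thesis by (simp add: inj_def)
qed

lemma inj_example_rank: "inj example_rank"
  using inj_bits_rank by (auto simp: inj_def example_rank_def)

lemma finite_training_data: "finite (training_data N f)"
proof -
  have "finite {x :: bits. set x \<subseteq> UNIV \<and> length x \<le> N}"
    by (rule finite_lists_length_le) simp
  moreover have "training_data N f = (\<lambda>x. (x, f x)) ` {x. set x \<subseteq> UNIV \<and> length x \<le> N}"
    by (auto simp: training_data_def)
  ultimately show ?thesis by simp
qed

lemma dataset_code_list:
  assumes "finite D"
  shows "set (sorted_key_list_of_set example_rank D) = D"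
    and "distinct (sorted_key_list_of_set example_rank D)"
    and "sorted (map example_rank (sorted_key_list_of_set example_rank D))"
proof -
  interpret folding_insort_key "(\<le>)" "(<)" UNIV example_rank
    by unfold_locales (rule inj_example_rank)
  have ins: "linorder.insort_key (\<le>) = (insort_key :: (bits \<times> bool \<Rightarrow> nat) \<Rightarrow> _)"
  proof (intro ext)
    fix k :: "bits \<times> bool \<Rightarrow> nat" and x xs
    show "linorder.insort_key (\<le>) k x xs = insort_key k x xs"
      by (induction xs) (simp_all add: linorder.insort_key.simps[OF linorder_axioms])
  qed
  have eq: "linorder.sorted_key_list_of_set (\<le>)
      = (sorted_key_list_of_set :: (bits \<times> bool \<Rightarrow> nat) \<Rightarrow> _)"
    by (simp add: fun_eq_iff linorder.sorted_key_list_of_set_def[OF linorder_axioms]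
        linorder_class.sorted_key_list_of_set_def ins)
  show "set (sorted_key_list_of_set example_rank D) = D"
    "distinct (sorted_key_list_of_set example_rank D)"
    "sorted (map example_rank (sorted_key_list_of_set example_rank D))"
    using set_sorted_key_list_of_set[of D] sorted_sorted_key_list_of_set[of D]
      distinct_sorted_key_list_of_set[of D] assms
    by (auto simp: distinct_map eq)
qed

lemma ex_mci: "\<exists>A. is_mci R C A"
proof -
  have "is_arg_min C (\<lambda>p. consistent R p D) (ARG_MIN C p. consistent R p D)"
    if "\<exists>p. consistent R p D" for D
    using that arg_min_nat_lemma[of "\<lambda>p. consistent R p D" _ C]
    by (auto simp: is_arg_min_linorder)
  then have "is_mci R C (\<lambda>D. ARG_MIN C p. consistent R p D)"
    by (simp add: is_mci_def)
  then show ?thesis by blast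
qed

lemma mci_enum_is_mci:
  assumes "assumption_E C E"
  shows "is_mci R C (mci_enum R E)"
  unfolding is_mci_def
proof (intro allI impI)
  fix D assume "finite D \<and> (\<exists>p. consistent R p D)"
  then obtain p where p: "consistent R p D" by blast
  have surj: "range E = UNIV" and mono: "\<And>i i'. i \<le> i' \<Longrightarrow> C (E i) \<le> C (E i')"
    using assms by (auto simp: assumption_E_def)
  let ?i = "LEAST i. consistent R (E i) D"
  obtain j where "p = E j" using surj by (metis UNIV_I image_iff)
  then have "consistent R (E ?i) D" using p by (auto intro: LeastI)
  moreover have "C (E ?i) \<le> C q" if "consistent R q D" for q
  proof -
    obtain k where "q = E k" using surj by (metis UNIV_I image_iff)
    then show ?thesis using that by (auto intro!: mono Least_le)
  qed
  ultimately show "is_arg_min C (\<lambda>p. consistent R p D) (mci_enum R E D)"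
    by (simp add: is_arg_min_linorder mci_enum_def)
qed

end

(*
  The interpolator returns a string of complexity at most that of the target f, so it errs only
  if two functions in the class up to the complexity of f agree on the data; conversely no
  algorithm can tell such functions apart.  If C is not computable, an optimal algorithm for a
  fixed c with finite N(F_c) searches a finite list of strings for the finitely many functions.

  Computability of the interpolator requires a universal machine, since the encoding system
  outputs descriptions of arbitrary machines.  Programs on finitely many bit stacks are compiled
  to one-tape machines; binary trees, stored on a stack in prefix notation, serve as data; and a
  machine step is a tree function built from a few closure properties.

  A rate Nhat that is valid for the functions of complexity exactly c need not be monotone in c:
  the computable bound on N(F_c) is the sum of Nhat over all complexities up to c.
*)

theory Submission
  imports Defs "HOL-Library.Countable"
begin

section \<open>Machines with a countable set of states\<close>

text \<open>Every algorithm here is only partially defined: a simulation stops only where the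
  simulated machine halts, and the search only where some string fits. Computability is therefore
  always relative to a precondition, \<open>comp_on P f\<close>, and the closure rules carry the
  obligations about halting; an iteration enters as an inductive derivation \<open>loops\<close>,
  which a run can have only if it ends. A program must also leave everything below its argument
  untouched, and prefix notation provides this because a code marks its own end. One convention
  removes most case distinctions: \<open>Lf\<close> is at once the number 0, the blank, the bit
  False, the empty list and the answer that nothing speaks against a candidate. So a conditional on
  \<open>Lf\<close> is the only test, and the defaults \<open>left Lf = Lf\<close> and
  \<open>right Lf = Lf\<close> agree with reading blanks beyond the ends of a tape. A fixed machine,
  such as the encoding system or the enumerator, enters a tree program through its table, a constant
  tree handed to \<open>univ\<close>.\<close>

definition cell :: "nat list \<Rightarrow> nat \<Rightarrow> nat" where
  "cell xs i = (if i < length xs then xs ! i else 0)"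

lemma cell_simps [simp]:
  "cell [] i = 0"
  "cell (x # xs) 0 = x"
  "cell (x # xs) (Suc i) = cell xs i"
  "cell (tl xs) i = cell xs (Suc i)"
  "head_symbol xs = cell xs 0"
  by (auto simp: cell_def nth_tl) (cases xs; simp)

fun moved :: "move \<Rightarrow> nat \<Rightarrow> nat" where
  "moved MLeft h = h - 1"
| "moved MStay h = h"
| "moved MRight h = Suc h"

text \<open>Positions are natural numbers: the cells to the left of position 0 are never visited.\<close>

definition tape_rep :: "nat \<Rightarrow> (nat \<Rightarrow> nat) \<Rightarrow> nat list \<Rightarrow> nat list \<Rightarrow> bool" where
  "tape_rep h t ls rs \<longleftrightarrow> (\<forall>i. cell rs i = t (h + i)) \<and> (\<forall>i<h. cell ls i = t (h - Suc i))"

lemma tape_rep_act: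
  assumes "tape_rep h t ls rs" "d = MLeft \<Longrightarrow> h > 0"
  shows "case act d b ls rs of (ls', rs') \<Rightarrow> tape_rep (moved d h) (t(h := b)) ls' rs'"
proof (cases d)
  case MLeft
  then obtain h' where h: "h = Suc h'" using assms(2) by (cases h) auto
  \<comment> \<open>Cell 0 of the new right half is the nearest cell of the old left half and cell 1
    is the written one; hence the second split on \<open>i - 1\<close>.\<close>
  have "cell (cell ls 0 # b # tl rs) i = (t(h := b)) (h' + i)" for i
    using assms(1) h
    by (cases i; cases "i - 1") (auto simp: tape_rep_def)
  then show ?thesis using MLeft assms(1) h by (auto simp: tape_rep_def)
next
  case MStay
  have "cell (b # tl rs) i = (t(h := b)) (h + i)" for i
    using assms(1) by (cases i) (auto simp: tape_rep_def)
  then show ?thesis using MStay assms(1) by (auto simp: tape_rep_def)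
next
  case MRight
  have "cell (b # ls) i = (t(h := b)) (h - i)" if "i < Suc h" for i
    using assms(1) that by (cases i) (auto simp: tape_rep_def)
  then show ?thesis using MRight assms(1) by (auto simp: tape_rep_def)
qed

type_synonym 'q delta = "'q \<Rightarrow> nat \<Rightarrow> ('q \<times> nat \<times> move) option"

text \<open>With a tape indexed by positions, writing is a function update, and a free state type
  allows structured states. A left move from position 0 is no step, so the truncated subtraction in
  \<open>moved\<close> never takes effect.\<close>

inductive mstep :: "'q delta \<Rightarrow> 'q \<times> nat \<times> (nat \<Rightarrow> nat) \<Rightarrow> 'q \<times> nat \<times> (nat \<Rightarrow> nat) \<Rightarrow> bool"
  for \<delta> where
  "\<delta> q (t h) = Some (q', b, d) \<Longrightarrow> d = MLeft \<longrightarrow> h > 0 \<Longrightarrow>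
     mstep \<delta> (q, h, t) (q', moved d h, t(h := b))"

abbreviation "mrun \<delta> \<equiv> (mstep \<delta>)\<^sup>*\<^sup>*"

lemmas mrun_trans [trans] =
  rtranclp_trans[of "mstep \<delta>" for \<delta>]
  converse_rtranclp_into_rtranclp[of "mstep \<delta>" for \<delta>]
  rtranclp.rtrancl_into_rtrancl[of "mstep \<delta>" for \<delta>]
  rtranclp_trans[OF r_into_rtranclp r_into_rtranclp, of "mstep \<delta>" for \<delta>]

lemma mstep_right: "\<delta> q (t h) = Some (q', t h, MRight) \<Longrightarrow> mstep \<delta> (q, h, t) (q', Suc h, t)"
  using mstep.intros[of \<delta> q t h q' "t h" MRight] by simp

lemma mstep_stay: "\<delta> q (t h) = Some (q', t h, MStay) \<Longrightarrow> mstep \<delta> (q, h, t) (q', h, t)"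
  using mstep.intros[of \<delta> q t h q' "t h" MStay] by simp

lemma mstep_left: "\<delta> q (t (Suc h)) = Some (q', t (Suc h), MLeft) \<Longrightarrow> mstep \<delta> (q, Suc h, t) (q', h, t)"
  using mstep.intros[of \<delta> q t "Suc h" q' "t (Suc h)" MLeft] by simp

lemma mrun_right:
  assumes "\<And>i. h \<le> i \<Longrightarrow> i < h' \<Longrightarrow> \<delta> q (t i) = Some (q, t i, MRight)" "h \<le> h'"
  shows "mrun \<delta> (q, h, t) (q, h', t)"
  using assms(2,1)
proof (induction h' rule: dec_induct)
  case (step n)
  then show ?case
    using mstep_right[of \<delta> q t n q] by (auto intro: rtranclp.rtrancl_into_rtrancl)
qed simp

lemma mrun_left:
  assumes "\<And>i. h < i \<Longrightarrow> i \<le> h' \<Longrightarrow> \<delta> q (t i) = Some (q, t i, MLeft)" "h \<le> h'"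
  shows "mrun \<delta> (q, h', t) (q, h, t)"
  using assms(2,1)
proof (induction h' rule: dec_induct)
  case (step n)
  have "mstep \<delta> (q, Suc n, t) (q, n, t)"
    using step by (intro mstep_left) auto
  moreover have "mrun \<delta> (q, n, t) (q, h, t)" using step by simp
  ultimately show ?case by (rule converse_rtranclp_into_rtranclp)
qed simp

lemma finite_map_table:
  assumes "finite (dom m)"
  shows "\<exists>M. map_of M = m"
proof -
  obtain xs where xs: "set xs = dom m" using finite_list[OF assms] by auto
  \<comment> \<open>Repeated elements of \<open>xs\<close> do no harm, as equal keys get equal
    values.\<close>
  have "map_of (map (\<lambda>x. (x, the (m x))) xs) = m"
  proof
    fix x
    show "map_of (map (\<lambda>x. (x, the (m x))) xs) x = m x"
      using xs by (cases "m x") (auto simp: map_of_map_restrict restrict_map_def dom_def)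
  qed
  then show ?thesis by blast
qed

text \<open>Machines start in state 0, whereas \<open>to_nat\<close> may give any number to the
  initial state; hence the shift by one, which reserves 0. Injectivity of \<open>e\<close> lets the
  table be read back, so undefined transitions remain undefined.\<close>

lemma delta_table:
  fixes \<delta> :: "'q::countable delta"
  assumes "finite {(q, s). \<delta> q s \<noteq> None}"
  shows "\<exists>(M :: tm) (e :: 'q \<Rightarrow> nat). e q\<^sub>0 = 0 \<and>
    (\<forall>q s. map_of M (e q, s) = map_option (\<lambda>(q', b, d). (e q', b, d)) (\<delta> q s))"
proof -
  define n where "n = to_nat q\<^sub>0"
  define e :: "'q \<Rightarrow> nat" where
    "e q = (if q = q\<^sub>0 then 0 else Suc (to_nat q))" for q
  have inj: "e q = e q' \<longleftrightarrow> q = q'" for q q' by (auto simp: e_def)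
  define m where "m = (\<lambda>(k, s). if k \<in> range e then
    map_option (\<lambda>(q', b, d). (e q', b, d)) (\<delta> (inv e k) s) else None)"
  have inv: "inv e (e q) = q" for q using inj by (auto simp: inv_def)
  have "dom m \<subseteq> (\<lambda>(q, s). (e q, s)) ` {(q, s). \<delta> q s \<noteq> None}"
    by (auto simp: m_def inv split: if_splits) (force simp: inv)
  then have "finite (dom m)" using assms finite_surj by blast
  then obtain M where "map_of M = m" using finite_map_table by blast
  then have "map_of M (e q, s) = map_option (\<lambda>(q', b, d). (e q', b, d)) (\<delta> q s)" for q s
    by (simp add: m_def inv)
  moreover have "e q\<^sub>0 = 0" by (simp add: e_def)
  ultimately show ?thesis by blast
qed

lemma tm_simulates_mrun:
  fixes M :: tm and e :: "'q \<Rightarrow> nat"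
  assumes M: "\<And>q s. map_of M (e q, s) = map_option (\<lambda>(q', b, d). (e q', b, d)) (\<delta> q s)"
    and "mrun \<delta> (q, h, t) (q', h', t')" "tape_rep h t ls rs"
  shows "\<exists>ls' rs'. (\<lambda>c c'. tm_step M c = Some c')\<^sup>*\<^sup>* (e q, ls, rs) (e q', ls', rs') \<and>
    tape_rep h' t' ls' rs'"
  using assms(2,3)
proof (induction "(q', h', t')" arbitrary: q' h' t' rule: rtranclp_induct)
  case (step y)
  obtain q1 h1 t1 where y: "y = (q1, h1, t1)" by (cases y)
  obtain ls1 rs1 where
    1: "(\<lambda>c c'. tm_step M c = Some c')\<^sup>*\<^sup>* (e q, ls, rs) (e q1, ls1, rs1)"
    "tape_rep h1 t1 ls1 rs1"
    using step y by blast
  from step(2) y obtain b d where \<delta>: "\<delta> q1 (t1 h1) = Some (q', b, d)" "d = MLeft \<longrightarrow> h1 > 0"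
    "h' = moved d h1" "t' = t1(h1 := b)"
    by (auto elim: mstep.cases)
  have "cell rs1 0 = t1 h1" using 1(2) by (simp add: tape_rep_def)
  then have "tm_step M (e q1, ls1, rs1) = Some (e q', act d b ls1 rs1)"
    using \<delta>(1) M by simp
  moreover have "case act d b ls1 rs1 of (ls', rs') \<Rightarrow> tape_rep h' t' ls' rs'"
    using tape_rep_act[OF 1(2), of d b] \<delta> by simp
  ultimately show ?case
    using rtranclp.rtrancl_into_rtrancl[OF 1(1)] by (auto split: prod.splits)
qed blast

section \<open>Programs on bit stacks\<close>

type_synonym stacks = "nat \<Rightarrow> bool list"

text \<open>Popping also tests for emptiness and branches on the bit, because on the tape all three
  answers come from the same scan for the end of a track.\<close>

datatype com =
    Skip
  | Push nat bool
  | Seq com com  (infixr \<open>;;\<close> 60)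
  | Pop nat com com com
  | Loop nat com com

inductive exec :: "com \<Rightarrow> stacks \<Rightarrow> stacks \<Rightarrow> bool" where
  Skip: "exec Skip \<sigma> \<sigma>"
| Push: "exec (Push j b) \<sigma> (\<sigma>(j := b # \<sigma> j))"
| Seq: "exec c \<sigma> \<sigma>' \<Longrightarrow> exec d \<sigma>' \<sigma>'' \<Longrightarrow> exec (c ;; d) \<sigma> \<sigma>''"
| PopEmpty: "\<sigma> j = [] \<Longrightarrow> exec c \<sigma> \<tau> \<Longrightarrow> exec (Pop j c d d') \<sigma> \<tau>"
| PopBit: "\<sigma> j = b # s \<Longrightarrow> exec (if b then d else d') (\<sigma>(j := s)) \<tau> \<Longrightarrow> exec (Pop j c d d') \<sigma> \<tau>"
| LoopEmpty: "\<sigma> j = [] \<Longrightarrow> exec (Loop j d d') \<sigma> \<sigma>"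
| LoopBit: "\<sigma> j = b # s \<Longrightarrow> exec (if b then d else d') (\<sigma>(j := s)) \<sigma>' \<Longrightarrow>
    exec (Loop j d d') \<sigma>' \<tau> \<Longrightarrow> exec (Loop j d d') \<sigma> \<tau>"

fun com_ok :: "nat \<Rightarrow> com \<Rightarrow> bool" where
  "com_ok K Skip \<longleftrightarrow> True"
| "com_ok K (Push j b) \<longleftrightarrow> j < K"
| "com_ok K (c ;; d) \<longleftrightarrow> com_ok K c \<and> com_ok K d"
| "com_ok K (Pop j c d d') \<longleftrightarrow> j < K \<and> com_ok K c \<and> com_ok K d \<and> com_ok K d'"
| "com_ok K (Loop j d d') \<longleftrightarrow> j < K \<and> com_ok K d \<and> com_ok K d'"

section \<open>Layout of the stacks on the tape\<close>

text \<open>Cell 0 carries the marker 3.  The other cells hold one base-4 digit per stack, so that the raw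
  input is already the track of stack 0, read from the bottom.\<close>

definition track :: "bool list \<Rightarrow> nat \<Rightarrow> nat" where
  "track xs n = (if n < length xs then bit_symbol (rev xs ! n) else 0)"

lemma track_le: "track xs n \<le> 2"
  by (simp add: track_def bit_symbol_def)

lemma track_zero_iff: "track xs n = 0 \<longleftrightarrow> length xs \<le> n"
  by (simp add: track_def bit_symbol_def)

lemma track_Cons: "track (b # xs) = (track xs)(length xs := bit_symbol b)"
  by (auto simp: fun_eq_iff track_def nth_append)

definition digit :: "nat \<Rightarrow> nat \<Rightarrow> nat" where
  "digit j v = v div 4 ^ j mod 4"

lemma digits_bound:
  fixes d :: "nat \<Rightarrow> nat"
  shows "(\<And>j. d j < 4) \<Longrightarrow> (\<Sum>j<K. d j * 4 ^ j) < 4 ^ K"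
proof (induction K)
  case (Suc K)
  have "d K * 4 ^ K \<le> 3 * 4 ^ K" using Suc.prems[of K] by (intro mult_right_mono) auto
  moreover have "(\<Sum>j<K. d j * 4 ^ j) < 4 ^ K" using Suc by simp
  ultimately show ?case unfolding sum.lessThan_Suc power_Suc by linarith
qed simp

lemma digit_sum:
  fixes d :: "nat \<Rightarrow> nat"
  assumes "\<And>j. d j < 4"
  shows "j < K \<Longrightarrow> digit j (\<Sum>j<K. d j * 4 ^ j) = d j"
proof (induction K)
  case (Suc K)
  show ?case
  proof (cases "j = K")
    case True
    then show ?thesis using digits_bound[of d K, OF assms] assms[of K]
      by (simp add: digit_def)
  next
    case False
    then have "j < K" using Suc by simp
    then obtain i where K: "K = j + Suc i" using less_imp_Suc_add by force
    have "d K * 4 ^ K = 4 ^ j * (4 * (d K * 4 ^ i))"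
      by (simp add: K power_add)
    then have "(\<Sum>j<Suc K. d j * 4 ^ j) div 4 ^ j = (\<Sum>j<K. d j * 4 ^ j) div 4 ^ j + 4 * (d K * 4 ^ i)"
      by (simp only: sum.lessThan_Suc) simp
    then show ?thesis using Suc.IH[OF \<open>j < K\<close>] by (simp add: digit_def)
  qed
qed simp

definition tape :: "nat \<Rightarrow> stacks \<Rightarrow> nat \<Rightarrow> nat" where
  "tape K \<sigma> i = (if i = 0 then 3 else \<Sum>j<K. track (\<sigma> j) (i - 1) * 4 ^ j)"

lemma tape_0 [simp]: "tape K \<sigma> 0 = 3"
  by (simp add: tape_def)

lemma track_less: "track xs n < 4"
  using track_le[of xs n] by simp

lemma digit_tape: "j < K \<Longrightarrow> digit j (tape K \<sigma> (Suc i)) = track (\<sigma> j) i"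
  using digit_sum[of "\<lambda>j. track (\<sigma> j) i" j K, OF track_less] by (simp add: tape_def)

text \<open>The reason for base 4: tracks use only the digits 0, 1 and 2, so no packed cell has last
  digit 3 and the marker stays recognisable. In base 3 the marker would coincide with a cell that
  holds a bit of stack 1 only.\<close>

lemma tape_Suc_neq: "K > 0 \<Longrightarrow> tape K \<sigma> (Suc i) \<noteq> 3"
  using digit_tape[of 0 K \<sigma> i] track_le[of "\<sigma> 0" i] by (auto simp: digit_def)

lemma tape_less: "K > 0 \<Longrightarrow> tape K \<sigma> i < 4 ^ K"
  using digits_bound[of "\<lambda>j. track (\<sigma> j) (i - 1)" K, OF track_less] 
    power_increasing[of 1 K "4::nat"]
  by (auto simp: tape_def)

text \<open>The cell above the top bit has digit 0 in track \<open>j\<close>, so the digit is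
  written by an addition without carry. Read backwards, the equation also describes a pop.\<close>

lemma tape_push:
  assumes "j < K"
  shows "tape K (\<sigma>(j := b # \<sigma> j)) = (tape K \<sigma>)(Suc (length (\<sigma> j)) :=
    tape K \<sigma> (Suc (length (\<sigma> j))) + bit_symbol b * 4 ^ j)"
proof
  fix i
  have *: "track (if a = j then b # \<sigma> j else \<sigma> a) (length (\<sigma> j)) * 4 ^ a =
    track (\<sigma> a) (length (\<sigma> j)) * 4 ^ a + (if a = j then bit_symbol b * 4 ^ j else 0)" for a
    by (auto simp: track_Cons, simp add: track_def)
  show "tape K (\<sigma>(j := b # \<sigma> j)) i = ((tape K \<sigma>)(Suc (length (\<sigma> j)) :=
    tape K \<sigma> (Suc (length (\<sigma> j))) + bit_symbol b * 4 ^ j)) i"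
  proof (cases "i = Suc (length (\<sigma> j))")
    case True
    then show ?thesis using assms by (simp add: tape_def fun_upd_def * sum.distrib)
  next
    case False
    then show ?thesis by (auto simp: tape_def track_Cons intro!: sum.cong)
  qed
qed

text \<open>\<open>Start\<close> steps to the left of the input and \<open>Mark\<close> writes the
  marker there. \<open>PushR\<close> and \<open>PopR\<close> look for the end of a track;
  \<open>PopTake\<close> then stands on the top bit, or on the marker if the stack is empty. Leaving
  \<open>Run []\<close> erases the marker and moves to cell 1, where the output has to
  start.\<close>

datatype state =
    Start
  | Mark com
  | Run "com list"
  | PushR nat bool "com list"
  | PopR nat "com list" "com list" "com list"
  | PopTake nat "com list" "com list" "com list"
  | Return "com list"
  | Final

instance com :: countable by countable_datatype
instance state :: countable by countable_datatype

text \<open>A list of commands is the continuation of the run.  The head returns to cell 0 after each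
  command.\<close>

fun delta :: "com \<Rightarrow> state delta" where
  "delta p Start v = Some (Mark p, v, MLeft)"
| "delta p (Mark c) v = Some (Run [c], 3, MStay)"
| "delta p (Run []) v = Some (Final, 0, MRight)"
| "delta p (Run (Skip # k)) v = Some (Run k, v, MStay)"
| "delta p (Run (Push j b # k)) v = Some (PushR j b k, v, MRight)"
| "delta p (Run ((c ;; d) # k)) v = Some (Run (c # d # k), v, MStay)"
| "delta p (Run (Pop j c d d' # k)) v = Some (PopR j (c # k) (d # k) (d' # k), v, MRight)"
| "delta p (Run (Loop j d d' # k)) v =
     Some (PopR j k (d # Loop j d d' # k) (d' # Loop j d d' # k), v, MRight)"
| "delta p (PushR j b k) v =
     (if digit j v = 0 then Some (Return k, v + bit_symbol b * 4 ^ j, MLeft)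
      else Some (PushR j b k, v, MRight))"
| "delta p (PopR j k0 k1 k2) v =
     (if digit j v = 0 then Some (PopTake j k0 k1 k2, v, MLeft)
      else Some (PopR j k0 k1 k2, v, MRight))"
| "delta p (PopTake j k0 k1 k2) v =
     (if v = 3 then Some (Run k0, v, MStay)
      else if digit j v = 2 then Some (Return k1, v - 2 * 4 ^ j, MLeft)
      else Some (Return k2, v - 4 ^ j, MLeft))"
| "delta p (Return k) v = (if v = 3 then Some (Run k, v, MStay) else Some (Return k, v, MLeft))"
| "delta p Final v = None"

text \<open>\<open>delta\<close> is defined on infinitely many states and symbols, but a machine is
  a finite table.\<close>

definition restricted :: "com \<Rightarrow> nat \<Rightarrow> state set \<Rightarrow> state delta" where
  "restricted p K Q q v = (if q \<in> Q \<and> v < 4 ^ K then delta p q v else None)"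

definition pop_states :: "nat \<Rightarrow> com list \<Rightarrow> com list \<Rightarrow> com list \<Rightarrow> state set" where
  "pop_states j k0 k1 k2 = {PopR j k0 k1 k2, PopTake j k0 k1 k2, Return k1, Return k2}"

text \<open>The states that occur between the start of \<open>c\<close> and the moment when \<open>k\<close> is left to run.\<close>

fun states :: "com \<Rightarrow> com list \<Rightarrow> state set" where
  "states Skip k = {Run (Skip # k)}"
| "states (Push j b) k = {Run (Push j b # k), PushR j b k, Return k}"
| "states (c ;; d) k = {Run ((c ;; d) # k)} \<union> states c (d # k) \<union> states d k"
| "states (Pop j c d d') k = {Run (Pop j c d d' # k)} \<union> pop_states j (c # k) (d # k) (d' # k) \<union>
     states c k \<union> states d k \<union> states d' k"
| "states (Loop j d d') k = {Run (Loop j d d' # k)} \<union>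
     pop_states j k (d # Loop j d d' # k) (d' # Loop j d d' # k) \<union>
     states d (Loop j d d' # k) \<union> states d' (Loop j d d' # k)"

text \<open>The body of a loop is followed by the loop itself on top of \<open>k\<close>, so
  repeated rounds reuse the same continuations.\<close>

lemma finite_states: "finite (states c k)"
  by (induction c arbitrary: k) (auto simp: pop_states_def)

section \<open>Correctness of the compilation\<close>

context
  fixes p :: com and K :: nat and Q :: "state set"
  assumes K: "K > 0"
begin

abbreviation "\<Delta> \<equiv> restricted p K Q"

lemma restricted_tape: "q \<in> Q \<Longrightarrow> \<Delta> q (tape K \<sigma> i) = delta p q (tape K \<sigma> i)"
  using tape_less[OF K] by (simp add: restricted_def)

lemma mrun_return:
  assumes "Return k \<in> Q"
  shows "mrun \<Delta> (Return k, h, tape K \<sigma>) (Run k, 0, tape K \<sigma>)"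
proof -
  have "mrun \<Delta> (Return k, h, tape K \<sigma>) (Return k, 0, tape K \<sigma>)"
  proof (rule mrun_left)
    fix i :: nat assume "0 < i"
    then obtain i' where "i = Suc i'" by (cases i) auto
    then show "\<Delta> (Return k) (tape K \<sigma> i) = Some (Return k, tape K \<sigma> i, MLeft)"
      using tape_Suc_neq[OF K, of \<sigma> i'] by (simp add: restricted_tape assms)
  qed simp
  moreover have "mstep \<Delta> (Return k, 0, tape K \<sigma>) (Run k, 0, tape K \<sigma>)"
    \<comment> \<open>\<open>tape_0\<close> is withheld at first because
      \<open>restricted_tape\<close> applies only to a symbol of the form
      \<open>tape K \<sigma> i\<close>; the value 3 is then needed to choose the branch.\<close>
    by (intro mstep_stay) (simp add: restricted_tape assms del: tape_0, simp)
  ultimately show ?thesis by (rule rtranclp.rtrancl_into_rtrancl)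
qed

lemma mrun_push:
  assumes Q: "PushR j b k \<in> Q" "Return k \<in> Q" and j: "j < K"
  shows "mrun \<Delta> (PushR j b k, 1, tape K \<sigma>) (Run k, 0, tape K (\<sigma>(j := b # \<sigma> j)))"
proof -
  let ?n = "length (\<sigma> j)"
  have "mrun \<Delta> (PushR j b k, 1, tape K \<sigma>) (PushR j b k, Suc ?n, tape K \<sigma>)"
  proof (rule mrun_right)
    fix i assume "1 \<le> i" "i < Suc ?n"
    then obtain i' where "i = Suc i'" "i' < ?n" by (cases i) auto
    then show "\<Delta> (PushR j b k) (tape K \<sigma> i) = Some (PushR j b k, tape K \<sigma> i, MRight)"
      using j by (simp add: restricted_tape Q digit_tape track_zero_iff)
  qed simp
  also have "mstep \<Delta> (PushR j b k, Suc ?n, tape K \<sigma>)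
    (Return k, moved MLeft (Suc ?n), tape K (\<sigma>(j := b # \<sigma> j)))"
    unfolding tape_push[OF j]
    using j by (intro mstep.intros) (simp_all add: restricted_tape Q digit_tape track_zero_iff)
  also have "mrun \<Delta> (Return k, moved MLeft (Suc ?n), tape K (\<sigma>(j := b # \<sigma> j)))
    (Run k, 0, tape K (\<sigma>(j := b # \<sigma> j)))"
    by (rule mrun_return[OF Q(2)])
  finally show ?thesis .
qed

text \<open>Entry \<open>i\<close> of a track lies in cell \<open>Suc i\<close>. One step to the
  left of the first empty cell is therefore the top bit, or cell 0 with the marker if the stack is
  empty.\<close>

lemma mrun_pop_search:
  assumes Q: "PopR j k0 k1 k2 \<in> Q" and j: "j < K"
  shows "mrun \<Delta> (PopR j k0 k1 k2, 1, tape K \<sigma>) (PopTake j k0 k1 k2, length (\<sigma> j), tape K \<sigma>)"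
proof -
  let ?n = "length (\<sigma> j)"
  have "mrun \<Delta> (PopR j k0 k1 k2, 1, tape K \<sigma>) (PopR j k0 k1 k2, Suc ?n, tape K \<sigma>)"
  proof (rule mrun_right)
    fix i assume "1 \<le> i" "i < Suc ?n"
    then obtain i' where "i = Suc i'" "i' < ?n" by (cases i) auto
    then show "\<Delta> (PopR j k0 k1 k2) (tape K \<sigma> i) = Some (PopR j k0 k1 k2, tape K \<sigma> i, MRight)"
      using j by (simp add: restricted_tape Q digit_tape track_zero_iff)
  qed simp
  also have "mstep \<Delta> (PopR j k0 k1 k2, Suc ?n, tape K \<sigma>) (PopTake j k0 k1 k2, ?n, tape K \<sigma>)"
    using j by (intro mstep_left) (simp_all add: restricted_tape Q digit_tape track_zero_iff)
  finally show ?thesis .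
qed

lemma mrun_pop_empty:
  assumes Q: "pop_states j k0 k1 k2 \<subseteq> Q" and j: "j < K" and "\<sigma> j = []"
  shows "mrun \<Delta> (PopR j k0 k1 k2, 1, tape K \<sigma>) (Run k0, 0, tape K \<sigma>)"
proof -
  have "mrun \<Delta> (PopR j k0 k1 k2, 1, tape K \<sigma>) (PopTake j k0 k1 k2, 0, tape K \<sigma>)"
    using mrun_pop_search[of j k0 k1 k2 \<sigma>] Q j \<open>\<sigma> j = []\<close> by (simp add: pop_states_def)
  also have "mstep \<Delta> (PopTake j k0 k1 k2, 0, tape K \<sigma>) (Run k0, 0, tape K \<sigma>)"
    using Q by (intro mstep_stay) (simp add: restricted_tape pop_states_def del: tape_0, simp)
  finally show ?thesis .
qed

lemma mrun_pop_bit: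
  assumes Q: "pop_states j k0 k1 k2 \<subseteq> Q" and j: "j < K" and s: "\<sigma> j = b # s"
  shows "mrun \<Delta> (PopR j k0 k1 k2, 1, tape K \<sigma>) (Run (if b then k1 else k2), 0, tape K (\<sigma>(j := s)))"
proof -
  let ?k = "if b then k1 else k2" and ?\<tau> = "\<sigma>(j := s)" and ?n = "length s"
  \<comment> \<open>A pop is an inverted push: \<open>\<sigma>\<close> arises by pushing
    \<open>b\<close> onto the popped stack, so \<open>tape_push\<close> relates the two
    tapes.\<close>
  have \<sigma>: "\<sigma> = ?\<tau>(j := b # ?\<tau> j)" using s by (auto simp: fun_eq_iff)
  have push: "tape K \<sigma> = (tape K ?\<tau>)(Suc ?n := tape K ?\<tau> (Suc ?n) + bit_symbol b * 4 ^ j)"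
    using tape_push[OF j, of ?\<tau> b] \<sigma> by simp
  have digit: "digit j (tape K \<sigma> (Suc ?n)) = bit_symbol b"
    using j s by (simp add: digit_tape track_Cons)
  have "mrun \<Delta> (PopR j k0 k1 k2, 1, tape K \<sigma>) (PopTake j k0 k1 k2, Suc ?n, tape K \<sigma>)"
    using mrun_pop_search[of j k0 k1 k2 \<sigma>] Q j s by (simp add: pop_states_def)
  also have "mstep \<Delta> (PopTake j k0 k1 k2, Suc ?n, tape K \<sigma>) (Return ?k, moved MLeft (Suc ?n), tape K ?\<tau>)"
  proof -
    have "tape K ?\<tau> = (tape K \<sigma>)(Suc ?n := tape K \<sigma> (Suc ?n) - bit_symbol b * 4 ^ j)"
      by (simp add: push)
    moreover have "\<Delta> (PopTake j k0 k1 k2) (tape K \<sigma> (Suc ?n)) =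
        Some (Return ?k, tape K \<sigma> (Suc ?n) - bit_symbol b * 4 ^ j, MLeft)"
      using Q tape_Suc_neq[OF K, of \<sigma> ?n] digit
      by (simp add: restricted_tape pop_states_def bit_symbol_def)
    ultimately show ?thesis
      using mstep.intros[of \<Delta> "PopTake j k0 k1 k2" "tape K \<sigma>" "Suc ?n"] by simp
  qed
  also have "mrun \<Delta> (Return ?k, moved MLeft (Suc ?n), tape K ?\<tau>) (Run ?k, 0, tape K ?\<tau>)"
    using Q by (intro mrun_return) (auto simp: pop_states_def)
  finally show ?thesis .
qed

lemma mstep_run:
  assumes "Run (c # k) \<in> Q" "delta p (Run (c # k)) (tape K \<sigma> 0) = Some (q, tape K \<sigma> 0, d)"
    "d \<noteq> MLeft"
  shows "mstep \<Delta> (Run (c # k), 0, tape K \<sigma>) (q, moved d 0, tape K \<sigma>)"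
  using mstep.intros[of \<Delta> "Run (c # k)" "tape K \<sigma>" 0 q "tape K \<sigma> 0" d] assms
  by (simp add: restricted_tape del: tape_0)

text \<open>Induction on the run of the program. The continuation \<open>k\<close> is general
  because sequences and loops put further commands on it; \<open>Q\<close> is fixed, so all
  subprograms run on one machine.\<close>

lemma mrun_exec:
  "exec c \<sigma> \<tau> \<Longrightarrow> com_ok K c \<Longrightarrow> states c k \<subseteq> Q \<Longrightarrow>
    mrun \<Delta> (Run (c # k), 0, tape K \<sigma>) (Run k, 0, tape K \<tau>)"
proof (induction arbitrary: k rule: exec.induct)
  case (Skip \<sigma>)
  then show ?case using mstep_run[of Skip k \<sigma> "Run k" MStay] by auto
next
  case (Push j b \<sigma>)
  then have "mstep \<Delta> (Run (Push j b # k), 0, tape K \<sigma>) (PushR j b k, 1, tape K \<sigma>)"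
    using mstep_run[of "Push j b" k \<sigma> "PushR j b k" MRight] by simp
  also have "mrun \<Delta> (PushR j b k, 1, tape K \<sigma>) (Run k, 0, tape K (\<sigma>(j := b # \<sigma> j)))"
    using Push by (intro mrun_push) auto
  finally show ?case .
next
  case (Seq c \<sigma> \<sigma>' d \<sigma>'')
  then have "mstep \<Delta> (Run ((c ;; d) # k), 0, tape K \<sigma>) (Run (c # d # k), 0, tape K \<sigma>)"
    using mstep_run[of "c ;; d" k \<sigma> "Run (c # d # k)" MStay] by simp
  also have "mrun \<Delta> (Run (c # d # k), 0, tape K \<sigma>) (Run (d # k), 0, tape K \<sigma>')"
    using Seq by auto
  also have "mrun \<Delta> (Run (d # k), 0, tape K \<sigma>') (Run k, 0, tape K \<sigma>'')"
    using Seq by auto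
  finally show ?case .
next
  case (PopEmpty \<sigma> j c \<tau> d d')
  then have "mstep \<Delta> (Run (Pop j c d d' # k), 0, tape K \<sigma>)
    (PopR j (c # k) (d # k) (d' # k), 1, tape K \<sigma>)"
    using mstep_run[of "Pop j c d d'" k \<sigma> _ MRight] by simp
  also have "mrun \<Delta> (PopR j (c # k) (d # k) (d' # k), 1, tape K \<sigma>) (Run (c # k), 0, tape K \<sigma>)"
    using PopEmpty by (intro mrun_pop_empty) auto
  also have "mrun \<Delta> (Run (c # k), 0, tape K \<sigma>) (Run k, 0, tape K \<tau>)"
    using PopEmpty by auto
  finally show ?case .
next
  case (PopBit \<sigma> j b s d d' \<tau> c)
  then have "mstep \<Delta> (Run (Pop j c d d' # k), 0, tape K \<sigma>)
    (PopR j (c # k) (d # k) (d' # k), 1, tape K \<sigma>)"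
    using mstep_run[of "Pop j c d d'" k \<sigma> _ MRight] by simp
  also have "mrun \<Delta> (PopR j (c # k) (d # k) (d' # k), 1, tape K \<sigma>)
    (Run (if b then d # k else d' # k), 0, tape K (\<sigma>(j := s)))"
    using PopBit by (intro mrun_pop_bit) auto
  also have "mrun \<Delta> (Run (if b then d # k else d' # k), 0, tape K (\<sigma>(j := s))) (Run k, 0, tape K \<tau>)"
    using PopBit.IH[of k] PopBit.prems by (cases b) (auto simp del: fun_upd_apply)
  finally show ?case .
next
  case (LoopEmpty \<sigma> j d d')
  let ?l = "Loop j d d'"
  from LoopEmpty have "mstep \<Delta> (Run (?l # k), 0, tape K \<sigma>)
    (PopR j k (d # ?l # k) (d' # ?l # k), 1, tape K \<sigma>)"
    using mstep_run[of ?l k \<sigma> _ MRight] by simp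
  also have "mrun \<Delta> (PopR j k (d # ?l # k) (d' # ?l # k), 1, tape K \<sigma>) (Run k, 0, tape K \<sigma>)"
    using LoopEmpty by (intro mrun_pop_empty) auto
  finally show ?case .
next
  case (LoopBit \<sigma> j b s d d' \<sigma>' \<tau>)
  let ?l = "Loop j d d'"
  from LoopBit have "mstep \<Delta> (Run (?l # k), 0, tape K \<sigma>)
    (PopR j k (d # ?l # k) (d' # ?l # k), 1, tape K \<sigma>)"
    using mstep_run[of ?l k \<sigma> _ MRight] by simp
  also have "mrun \<Delta> (PopR j k (d # ?l # k) (d' # ?l # k), 1, tape K \<sigma>)
    (Run (if b then d # ?l # k else d' # ?l # k), 0, tape K (\<sigma>(j := s)))"
    using LoopBit by (intro mrun_pop_bit) auto
  also have "mrun \<Delta> (Run (if b then d # ?l # k else d' # ?l # k), 0, tape K (\<sigma>(j := s)))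
    (Run (?l # k), 0, tape K \<sigma>')"
    using LoopBit.IH(1)[of "?l # k"] LoopBit.prems by (cases b) (auto simp del: fun_upd_apply)
  also have "mrun \<Delta> (Run (?l # k), 0, tape K \<sigma>') (Run k, 0, tape K \<tau>)"
    using LoopBit by auto
  finally show ?case .
qed

end

section \<open>From compiled programs to machines with raw input and output\<close>

lemma takeWhile_track:
  assumes "\<And>i. cell rs i = track (rev y) i"
  shows "map (\<lambda>a. a = 2) (takeWhile (\<lambda>a. a = 1 \<or> a = 2) rs) = y"
  using assms
proof (induction y arbitrary: rs)
  case Nil
  then show ?case by (cases rs) (auto simp: track_def dest: spec[of _ 0] meta_spec[of _ 0])
next
  case (Cons b y)
  have 0: "cell rs 0 = bit_symbol b" using Cons.prems[of 0] by (simp add: track_def)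
  then obtain rs' where rs: "rs = bit_symbol b # rs'"
    by (cases rs) (auto simp: bit_symbol_def split: if_splits)
  have "cell rs' i = track (rev y) i" for i
    using Cons.prems[of "Suc i"] by (simp add: rs track_def)
  then show ?case using Cons.IH[of rs'] by (auto simp: rs bit_symbol_def)
qed

definition input :: "bool list \<Rightarrow> stacks" where
  "input x = (\<lambda>_. [])(0 := x)"

lemma tape_input: "K > 0 \<Longrightarrow> tape K (input x) (Suc i) = track x i"
proof -
  assume "K > 0"
  have "(\<Sum>j<K. track (input x j) i * 4 ^ j) = (\<Sum>j<K. if j = 0 then track x i else 0)"
    by (intro sum.cong) (auto simp: input_def track_def)
  then show ?thesis using \<open>K > 0\<close> by (simp add: tape_def)
qed

text \<open>A track begins at the bottom of its stack, so the raw input has its last bit on top;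
  hence the reversals on both sides. The other stacks are empty at the end, so the cells are plain
  bit symbols again. The index set \<open>I\<close> makes one machine serve a whole family of
  inputs.\<close>

lemma tm_of_com:
  assumes ok: "com_ok K c" and K: "K > 0"
    and exec: "\<And>i. i \<in> I \<Longrightarrow> exec c (input (rev (x i))) (input (rev (y i)))"
  shows "\<exists>M. \<forall>i\<in>I. tm_computes M (x i) (y i)"
proof -
  define Q where "Q = {Start, Mark c, Run []} \<union> states c []"
  let ?\<Delta> = "restricted c K Q"
  have "{(q, s). ?\<Delta> q s \<noteq> None} \<subseteq> Q \<times> {..<4 ^ K}"
    by (auto simp: restricted_def split: if_splits)
  then have "finite {(q, s). ?\<Delta> q s \<noteq> None}"
    by (rule finite_subset) (simp add: Q_def finite_states)
  then obtain M :: tm and e where e: "e Start = 0"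
    and M: "\<And>q s. map_of M (e q, s) = map_option (\<lambda>(q', b, d). (e q', b, d)) (?\<Delta> q s)"
    using delta_table[of ?\<Delta> Start] by blast
  have "tm_computes M (x i) (y i)" if "i \<in> I" for i
  proof -
    \<comment> \<open>The tape before the marker is written. The head starts at position 1, which
      leaves room for the marker to its left.\<close>
    define t where "t = (tape K (input (rev (x i))))(0 := 0)"
    have t: "t (Suc n) = cell (map bit_symbol (x i)) n" for n
      using tape_input[OF K, of "rev (x i)" n] by (simp add: t_def track_def cell_def)
    have t_less: "t i < 4 ^ K" for i using tape_less[OF K] by (simp add: t_def)
    have "mstep ?\<Delta> (Start, 1, t) (Mark c, 0, t)"
      using t_less by (simp add: restricted_def Q_def mstep_left)
    also have "mstep ?\<Delta> (Mark c, 0, t) (Run [c], 0, tape K (input (rev (x i))))"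
    proof -
      have "mstep ?\<Delta> (Mark c, 0, t) (Run [c], moved MStay 0, t(0 := 3))"
        using t_less by (intro mstep.intros) (simp_all add: restricted_def Q_def)
      moreover have "t(0 := 3) = tape K (input (rev (x i)))" by (auto simp: t_def fun_eq_iff)
      ultimately show ?thesis by simp
    qed
    also have "mrun ?\<Delta> (Run [c], 0, tape K (input (rev (x i)))) (Run [], 0, tape K (input (rev (y i))))"
      using exec[OF that] ok K by (intro mrun_exec) (auto simp: Q_def)
    also have "mstep ?\<Delta> (Run [], 0, tape K (input (rev (y i))))
      (Final, moved MRight 0, (tape K (input (rev (y i))))(0 := 0))"
      using tape_less[OF K, of "input (rev (y i))" 0]
      by (intro mstep.intros) (simp_all add: restricted_def Q_def)
    finally have "mrun ?\<Delta> (Start, 1, t) (Final, 1, (tape K (input (rev (y i))))(0 := 0))"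
      by simp
    from tm_simulates_mrun[OF M this, of "[]" "map bit_symbol (x i)"]
    obtain ls rs where run: "(\<lambda>c c'. tm_step M c = Some c')\<^sup>*\<^sup>* (0, [], map bit_symbol (x i)) (e Final, ls, rs)"
      and rep: "tape_rep 1 ((tape K (input (rev (y i))))(0 := 0)) ls rs"
      by (auto simp: e tape_rep_def t) (auto simp: t_def)
    have "map_of M (e Final, s) = None" for s
      by (simp add: M restricted_def)
    then have "tm_step M (e Final, ls, rs) = None" by simp
    moreover have "tm_output (e Final, ls, rs) = y i"
      using rep takeWhile_track[of rs "y i"] tape_input[OF K, of "rev (y i)"]
      by (simp add: tape_rep_def)
    ultimately show ?thesis
      using run unfolding tm_computes_def initial_config_def by blast
  qed
  then show ?thesis by blast
qed

text \<open>Stack 0 holds the trees, stacks 1 to 3 are scratch space that every complete tree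
  operation leaves empty, and stack 4 controls iteration.\<close>

definition mem :: "bool list \<Rightarrow> bool list \<Rightarrow> bool list \<Rightarrow> bool list \<Rightarrow> bool list \<Rightarrow> stacks" where
  "mem a b c d e = (\<lambda>_. [])(0 := a, Suc 0 := b, 2 := c, 3 := d, 4 := e)"

lemma mem_simps [simp]:
  "mem a b c d e 0 = a" "mem a b c d e (Suc 0) = b" "mem a b c d e 2 = c"
  "mem a b c d e 3 = d" "mem a b c d e 4 = e"
  "(mem a b c d e)(0 := x) = mem x b c d e"
  "(mem a b c d e)(Suc 0 := x) = mem a x c d e"
  "(mem a b c d e)(2 := x) = mem a b x d e"
  "(mem a b c d e)(3 := x) = mem a b c x e"
  "(mem a b c d e)(4 := x) = mem a b c d x"
  by (auto simp: mem_def fun_eq_iff)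

lemma input_mem: "input x = mem x [] [] [] []"
  by (auto simp: input_def mem_def)

section \<open>Symbolic execution of programs\<close>

inductive_cases exec_SkipE: "exec Skip \<sigma> \<tau>"
inductive_cases exec_PushE: "exec (Push j b) \<sigma> \<tau>"
inductive_cases exec_SeqE: "exec (c ;; d) \<sigma> \<tau>"
inductive_cases exec_PopE: "exec (Pop j c d d') \<sigma> \<tau>"
inductive_cases exec_LoopE: "exec (Loop j d d') \<sigma> \<tau>"

lemma exec_Pop_bit:
  "\<sigma> j = b # s \<Longrightarrow> exec (Pop j c d d') \<sigma> \<tau> \<longleftrightarrow> exec (if b then d else d') (\<sigma>(j := s)) \<tau>"
  by (rule iffI, erule exec_PopE) (auto intro: exec.intros simp del: fun_upd_apply)

lemma exec_Loop_bit:
  "\<sigma> j = b # s \<Longrightarrow> exec (Loop j d d') \<sigma> \<tau> \<longleftrightarrow>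
     (\<exists>\<rho>. exec (if b then d else d') (\<sigma>(j := s)) \<rho> \<and> exec (Loop j d d') \<rho> \<tau>)"
  by (rule iffI, erule exec_LoopE) (fastforce intro: exec.intros simp del: fun_upd_apply)+

text \<open>As equivalences, these rules let the simplifier run a program on known stacks.\<close>

lemma exec_simps [simp]:
  "exec Skip \<sigma> \<tau> \<longleftrightarrow> \<tau> = \<sigma>"
  "exec (Push j b) \<sigma> \<tau> \<longleftrightarrow> \<tau> = \<sigma>(j := b # \<sigma> j)"
  "exec (c ;; d) \<sigma> \<tau> \<longleftrightarrow> (\<exists>\<rho>. exec c \<sigma> \<rho> \<and> exec d \<rho> \<tau>)"
  "\<sigma> j = [] \<Longrightarrow> exec (Pop j c d d') \<sigma> \<tau> \<longleftrightarrow> exec c \<sigma> \<tau>"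
  "\<sigma> j = True # s \<Longrightarrow> exec (Pop j c d d') \<sigma> \<tau> \<longleftrightarrow> exec d (\<sigma>(j := s)) \<tau>"
  "\<sigma> j = False # s \<Longrightarrow> exec (Pop j c d d') \<sigma> \<tau> \<longleftrightarrow> exec d' (\<sigma>(j := s)) \<tau>"
  "\<sigma> j = [] \<Longrightarrow> exec (Loop j d d') \<sigma> \<tau> \<longleftrightarrow> \<tau> = \<sigma>"
  "\<sigma> j = True # s \<Longrightarrow> exec (Loop j d d') \<sigma> \<tau> \<longleftrightarrow>
     (\<exists>\<rho>. exec d (\<sigma>(j := s)) \<rho> \<and> exec (Loop j d d') \<rho> \<tau>)"
  "\<sigma> j = False # s \<Longrightarrow> exec (Loop j d d') \<sigma> \<tau> \<longleftrightarrow>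
     (\<exists>\<rho>. exec d' (\<sigma>(j := s)) \<rho> \<and> exec (Loop j d d') \<rho> \<tau>)"
  by (auto intro: exec.intros elim: exec_SkipE exec_PushE exec_SeqE exec_PopE exec_LoopE
      simp: exec_Pop_bit[where b = True] exec_Pop_bit[where b = False]
        exec_Loop_bit[where b = True] exec_Loop_bit[where b = False] simp del: fun_upd_apply)

definition transfer :: "nat \<Rightarrow> nat \<Rightarrow> com" where
  "transfer i j = Loop i (Push j True) (Push j False)"

lemma exec_transfer [simp]:
  assumes "i \<noteq> j"
  shows "exec (transfer i j) \<sigma> \<tau> \<longleftrightarrow> \<tau> = \<sigma>(i := [], j := rev (\<sigma> i) @ \<sigma> j)"
proof -
  have "\<sigma> i = xs \<Longrightarrow> exec (transfer i j) \<sigma> \<tau> \<longleftrightarrow> \<tau> = \<sigma>(i := [], j := rev xs @ \<sigma> j)" for xs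
  proof (induction xs arbitrary: \<sigma>)
    case Nil
    then have "\<sigma>(i := [], j := \<sigma> j) = \<sigma>" by (auto simp: fun_eq_iff)
    then show ?case using Nil by (simp add: transfer_def del: fun_upd_apply)
  next
    case (Cons b xs)
    let ?\<sigma> = "\<sigma>(i := xs, j := b # \<sigma> j)"
    have "exec (transfer i j) \<sigma> \<tau> \<longleftrightarrow> exec (transfer i j) ?\<sigma> \<tau>"
      using Cons.prems assms by (cases b) (simp_all add: transfer_def)
    also have "\<dots> \<longleftrightarrow> \<tau> = \<sigma>(i := [], j := rev (b # xs) @ \<sigma> j)"
    proof -
      have "?\<sigma>(i := [], j := rev xs @ ?\<sigma> j) = \<sigma>(i := [], j := rev (b # xs) @ \<sigma> j)"
        using assms by (auto simp: fun_eq_iff)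
      moreover have "?\<sigma> i = xs" using assms by simp
      ultimately show ?thesis using Cons.IH[of ?\<sigma>] by metis
    qed
    finally show ?case .
  qed
  then show ?thesis by simp
qed

definition clear :: "nat \<Rightarrow> com" where
  "clear i = Loop i Skip Skip"

lemma exec_clear [simp]: "exec (clear i) \<sigma> \<tau> \<longleftrightarrow> \<tau> = \<sigma>(i := [])"
proof -
  have "\<sigma> i = xs \<Longrightarrow> exec (clear i) \<sigma> \<tau> \<longleftrightarrow> \<tau> = \<sigma>(i := [])" for xs
  proof (induction xs arbitrary: \<sigma>)
    case Nil
    then have "\<sigma>(i := []) = \<sigma>" by (auto simp: fun_eq_iff)
    then show ?case using Nil by (simp add: clear_def del: fun_upd_apply)
  next
    case (Cons b xs)
    have "exec (clear i) \<sigma> \<tau> \<longleftrightarrow> exec (clear i) (\<sigma>(i := xs)) \<tau>"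
      using Cons.prems by (cases b) (simp_all add: clear_def)
    then show ?case using Cons.IH[of "\<sigma>(i := xs)"] by (simp del: fun_upd_apply add: fun_upd_same)
  qed
  then show ?thesis by simp
qed

lemma com_ok_aux [simp]:
  "com_ok K (transfer i j) \<longleftrightarrow> i < K \<and> j < K"
  "com_ok K (clear i) \<longleftrightarrow> i < K"
  by (auto simp: transfer_def clear_def)

section \<open>Computable functions on trees\<close>

datatype tree = Lf | Nd tree tree

primrec code :: "tree \<Rightarrow> bool list" where
  "code Lf = [False]"
| "code (Nd a b) = True # code a @ code b"

text \<open>Stack 2 holds one token per subtree that remains to be read.\<close>

definition grab_loop :: com where
  "grab_loop = Loop 2 (Pop 0 Skip (Push (Suc 0) True ;; Push 2 True ;; Push 2 True) (Push (Suc 0) False)) Skip"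

text \<open>A node uses up one token and adds two, one for each child, so the two induction
  hypotheses apply in turn; for this the surplus tokens \<open>n\<close> are arbitrary.\<close>

lemma exec_grab_loop:
  "exec grab_loop (mem (code t @ s) r (True # n) d e) \<tau> \<longleftrightarrow>
   exec grab_loop (mem s (rev (code t) @ r) n d e) \<tau>"
proof (induction t arbitrary: s r n)
  case Lf
  then show ?case by (simp add: grab_loop_def)
next
  case (Nd a b)
  have "exec grab_loop (mem (code (Nd a b) @ s) r (True # n) d e) \<tau> \<longleftrightarrow>
    exec grab_loop (mem (code a @ code b @ s) (True # r) (True # True # n) d e) \<tau>"
    by (simp add: grab_loop_def)
  then show ?case by (simp add: Nd)
qed

definition grab :: com where
  "grab = Push 2 True ;; grab_loop"

lemma exec_grab [simp]:
  "exec grab (mem (code t @ s) r [] d e) \<tau> \<longleftrightarrow> \<tau> = mem s (rev (code t) @ r) [] d e"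
  "exec grab (mem (code t) r [] d e) \<tau> \<longleftrightarrow> \<tau> = mem [] (rev (code t) @ r) [] d e"
  using exec_grab_loop[of t s r "[]" d e \<tau>] exec_grab_loop[of t "[]" r "[]" d e \<tau>]
  by (auto simp: grab_def grab_loop_def)

definition drop_tree :: com where
  "drop_tree = grab ;; clear (Suc 0)"

lemma exec_drop_tree [simp]:
  "exec drop_tree (mem (code t @ s) [] [] d e) \<tau> \<longleftrightarrow> \<tau> = mem s [] [] d e"
  by (simp add: drop_tree_def)

text \<open>Emptying stack 1 onto both stack 0 and stack 3 duplicates its content.\<close>

definition dup_tree :: com where
  "dup_tree = grab ;; Loop (Suc 0) (Push 0 True ;; Push 3 True) (Push 0 False ;; Push 3 False) ;;
     transfer 3 1 ;; transfer 1 0"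

lemma exec_both:
  "exec (Loop (Suc 0) (Push 0 True ;; Push 3 True) (Push 0 False ;; Push 3 False)) (mem s r c d e) \<tau>
     \<longleftrightarrow> \<tau> = mem (rev r @ s) [] c (rev r @ d) e"
proof (induction r arbitrary: s d)
  case (Cons b r)
  then show ?case by (cases b) simp_all
qed simp

lemma exec_dup_tree [simp]:
  "exec dup_tree (mem (code t @ s) [] [] [] e) \<tau> \<longleftrightarrow> \<tau> = mem (code t @ code t @ s) [] [] [] e"
  by (simp add: dup_tree_def exec_both)

text \<open>Every move between stacks reverses, so each tree must be moved an even number of times;
  the first one therefore takes the detour through stacks 3 and 2.\<close>

definition swap_trees :: com where
  "swap_trees = grab ;; transfer (Suc 0) 3 ;; grab ;; transfer 3 2 ;; transfer 2 0 ;; transfer (Suc 0) 0"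

lemma exec_swap_trees [simp]:
  "exec swap_trees (mem (code t @ code u @ s) [] [] [] e) \<tau> \<longleftrightarrow> \<tau> = mem (code u @ code t @ s) [] [] [] e"
  by (simp add: swap_trees_def)

lemma com_ok_trees [simp]: "com_ok 5 drop_tree" "com_ok 5 dup_tree" "com_ok 5 swap_trees"
  by (simp_all add: drop_tree_def dup_tree_def swap_trees_def grab_def grab_loop_def)

section \<open>Closure properties of the computable tree functions\<close>

primrec left :: "tree \<Rightarrow> tree" where
  "left Lf = Lf"
| "left (Nd a b) = a"

primrec right :: "tree \<Rightarrow> tree" where
  "right Lf = Lf"
| "right (Nd a b) = b"

definition main :: "bool list \<Rightarrow> stacks" where
  "main s = mem s [] [] [] []"

text \<open>The program must work on top of any stack content, so that arguments can be saved below.\<close>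

definition realizes :: "com \<Rightarrow> (tree \<Rightarrow> bool) \<Rightarrow> (tree \<Rightarrow> tree) \<Rightarrow> bool" where
  "realizes c P f \<longleftrightarrow> com_ok 5 c \<and> (\<forall>x s. P x \<longrightarrow> exec c (main (code x @ s)) (main (code (f x) @ s)))"

definition comp_on :: "(tree \<Rightarrow> bool) \<Rightarrow> (tree \<Rightarrow> tree) \<Rightarrow> bool" where
  "comp_on P f \<longleftrightarrow> (\<exists>c. realizes c P f)"

abbreviation comp :: "(tree \<Rightarrow> tree) \<Rightarrow> bool" where
  "comp \<equiv> comp_on (\<lambda>_. True)"

named_theorems comp_intros

text \<open>Besides exchanging equal functions, this shrinks the domain, as the branches of
  \<open>comp_if\<close> require.\<close>

lemma comp_on_cong: "comp_on P f \<Longrightarrow> (\<And>x. Q x \<Longrightarrow> P x \<and> f x = g x) \<Longrightarrow> comp_on Q g"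
  unfolding comp_on_def realizes_def by metis

lemma comp_on_compose:
  assumes "comp_on P f" "comp_on Q g" "\<And>x. P x \<Longrightarrow> Q (f x)"
  shows "comp_on P (\<lambda>x. g (f x))"
proof -
  obtain c d where "realizes c P f" "realizes d Q g" using assms by (auto simp: comp_on_def)
  then have "realizes (c ;; d) P (\<lambda>x. g (f x))" using assms(3) by (fastforce simp: realizes_def)
  then show ?thesis by (auto simp: comp_on_def)
qed

lemma comp_compose: "comp g \<Longrightarrow> comp_on P f \<Longrightarrow> comp_on P (\<lambda>x. g (f x))"
  by (rule comp_on_compose) auto

lemma comp_id [comp_intros]: "comp_on P (\<lambda>x. x)"
proof -
  have "realizes Skip P (\<lambda>x. x)" by (simp add: realizes_def)
  then show ?thesis by (auto simp: comp_on_def)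
qed

text \<open>Beneath the popped root symbol lie the codes of the two children. A popped leaf is put
  back, which yields the default value.\<close>

lemma comp_left [comp_intros]: "comp_on P f \<Longrightarrow> comp_on P (\<lambda>x. left (f x))"
proof (rule comp_compose[of left])
  have "exec (Pop 0 Skip (swap_trees ;; drop_tree) (Push 0 False)) (main (code x @ s)) (main (code (left x) @ s))" for x s
    by (cases x) (simp_all add: main_def)
  then have "realizes (Pop 0 Skip (swap_trees ;; drop_tree) (Push 0 False)) (\<lambda>_. True) left"
    by (simp add: realizes_def)
  then show "comp left" by (auto simp: comp_on_def)
qed

lemma comp_right [comp_intros]: "comp_on P f \<Longrightarrow> comp_on P (\<lambda>x. right (f x))"
proof (rule comp_compose[of right])
  have "exec (Pop 0 Skip drop_tree (Push 0 False)) (main (code x @ s)) (main (code (right x) @ s))" for x s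
    by (cases x) (simp_all add: main_def)
  then have "realizes (Pop 0 Skip drop_tree (Push 0 False)) (\<lambda>_. True) right"
    by (simp add: realizes_def)
  then show "comp right" by (auto simp: comp_on_def)
qed

lemma comp_Lf: "comp_on P (\<lambda>x. Lf)"
proof -
  have "realizes (drop_tree ;; Push 0 False) P (\<lambda>x. Lf)" by (simp add: realizes_def main_def)
  then show ?thesis by (auto simp: comp_on_def)
qed

lemma comp_Nd [comp_intros]:
  assumes "comp_on P f" "comp_on P g"
  shows "comp_on P (\<lambda>x. Nd (f x) (g x))"
proof -
  obtain c d where cd: "realizes c P f" "realizes d P g" using assms by (auto simp: comp_on_def)
  have "realizes (dup_tree ;; c ;; swap_trees ;; d ;; swap_trees ;; Push 0 True) P (\<lambda>x. Nd (f x) (g x))"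
    unfolding realizes_def
  proof (intro conjI allI impI)
    fix x s assume "P x"
    then have c: "exec c (main (code x @ code x @ s)) (main (code (f x) @ code x @ s))"
      and d: "exec d (main (code x @ code (f x) @ s)) (main (code (g x) @ code (f x) @ s))"
      using cd by (auto simp: realizes_def)
    show "exec (dup_tree ;; c ;; swap_trees ;; d ;; swap_trees ;; Push 0 True)
      (main (code x @ s)) (main (code (Nd (f x) (g x)) @ s))"
      apply (simp add: main_def)
      apply (rule exI, rule conjI, rule c[unfolded main_def])
      apply simp
      apply (rule exI, rule conjI, rule d[unfolded main_def])
      apply simp
      done
  qed (use cd in \<open>auto simp: realizes_def\<close>)
  then show ?thesis by (auto simp: comp_on_def)
qed

lemma comp_const [comp_intros]: "comp_on P (\<lambda>x. t)"
  by (induction t) (auto intro: comp_Lf comp_Nd)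

text \<open>Each branch need only be computable where it is taken, so a test can guard a partial
  function.\<close>

lemma comp_if [comp_intros]:
  assumes "comp_on P b" "comp_on (\<lambda>x. P x \<and> b x = Lf) f" "comp_on (\<lambda>x. P x \<and> b x \<noteq> Lf) g"
  shows "comp_on P (\<lambda>x. if b x = Lf then f x else g x)"
proof -
  obtain cb cf cg where c: "realizes cb P b" "realizes cf (\<lambda>x. P x \<and> b x = Lf) f"
    "realizes cg (\<lambda>x. P x \<and> b x \<noteq> Lf) g"
    using assms by (auto simp: comp_on_def)
  \<comment> \<open>Popping the root symbol decides the test. A leaf is thereby removed; for a node
    the symbol is pushed back so that \<open>drop_tree\<close> finds a complete code.\<close>
  let ?c = "dup_tree ;; cb ;; Pop 0 Skip (Push 0 True ;; drop_tree ;; cg) cf"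
  have "realizes ?c P (\<lambda>x. if b x = Lf then f x else g x)"
    unfolding realizes_def
  proof (intro conjI allI impI)
    fix x s assume P: "P x"
    then have cb: "exec cb (main (code x @ code x @ s)) (main (code (b x) @ code x @ s))"
      using c by (auto simp: realizes_def)
    show "exec ?c (main (code x @ s)) (main (code (if b x = Lf then f x else g x) @ s))"
    proof (cases "b x")
      case Lf
      then have "exec cf (main (code x @ s)) (main (code (f x) @ s))"
        using c P by (auto simp: realizes_def)
      then show ?thesis using cb Lf by (auto simp: main_def intro!: exI)
    next
      case (Nd t u)
      then have "exec cg (main (code x @ s)) (main (code (g x) @ s))"
        using c P by (auto simp: realizes_def)
      moreover have "exec drop_tree (mem (True # code t @ code u @ code x @ s) [] [] [] [])
          (mem (code x @ s) [] [] [] [])"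
        using exec_drop_tree[of "Nd t u" "code x @ s"] by simp
      ultimately show ?thesis using cb Nd by (auto simp: main_def intro!: exI)
    qed
  qed (use c in \<open>auto simp: realizes_def\<close>)
  then show ?thesis by (auto simp: comp_on_def)
qed

text \<open>The left component of \<open>f x\<close> tells whether the iteration goes on.\<close>

inductive loops :: "(tree \<Rightarrow> bool) \<Rightarrow> (tree \<Rightarrow> tree) \<Rightarrow> tree \<Rightarrow> tree \<Rightarrow> bool" for P f where
  stop: "P x \<Longrightarrow> f x = Nd Lf y \<Longrightarrow> loops P f x y"
| continue: "P x \<Longrightarrow> f x = Nd (Nd a b) y \<Longrightarrow> loops P f y z \<Longrightarrow> loops P f x z"

lemma loops_unique: "loops P f x y \<Longrightarrow> loops P f x z \<Longrightarrow> z = y"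
  by (induction rule: loops.induct) (auto elim: loops.cases)

definition iterate :: "(tree \<Rightarrow> bool) \<Rightarrow> (tree \<Rightarrow> tree) \<Rightarrow> tree \<Rightarrow> tree" where
  "iterate P f x = (THE y. loops P f x y)"

lemma iterate_eq: "loops P f x y \<Longrightarrow> iterate P f x = y"
  unfolding iterate_def using loops_unique by blast

lemma comp_loops:
  assumes "comp_on P f" "\<And>x. Q x \<Longrightarrow> loops P f x (g x)"
  shows "comp_on Q g"
proof -
  obtain c where c: "realizes c P f" using assms by (auto simp: comp_on_def)
  \<comment> \<open>A bit on stack 4 admits one further round. It is popped before \<open>c\<close>
    runs, so iterations inside \<open>c\<close> can use the same stack.\<close>
  let ?l = "Loop 4 (c ;; Pop 0 Skip (Pop 0 Skip (Push 0 True ;; drop_tree ;; Push 4 True) Skip) Skip) Skip"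
  have *: "exec ?l (mem (code x @ s) [] [] [] [True]) (main (code y @ s))" if "loops P f x y" for x y s
    using that
  proof (induction rule: loops.induct)
    case (stop x y)
    have "exec c (main (code x @ s)) (main (code (f x) @ s))" using c stop by (auto simp: realizes_def)
    then show ?case using stop by (auto simp: main_def intro!: exI)
  next
    case (continue x a b y z)
    have "exec c (main (code x @ s)) (main (code (f x) @ s))" using c continue by (auto simp: realizes_def)
    moreover have "exec drop_tree (mem (True # code a @ code b @ code y @ s) [] [] [] [])
          (mem (code y @ s) [] [] [] [])"
        using exec_drop_tree[of "Nd a b" "code y @ s"] by simp
    ultimately show ?case using continue by (auto simp: main_def intro!: exI)
  qed
  then have "realizes (Push 4 True ;; ?l) Q g"
    using assms(2) c by (auto simp: realizes_def main_def)
  then show ?thesis by (auto simp: comp_on_def)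
qed

lemma comp_iterate: "comp_on P f \<Longrightarrow> comp_on (\<lambda>x. \<exists>y. loops P f x y) (iterate P f)"
  by (rule comp_loops) (auto simp: iterate_eq)

section \<open>Bit strings as trees\<close>

definition tbit :: "bool \<Rightarrow> tree" where
  "tbit b = (if b then Nd Lf Lf else Lf)"

primrec tlist :: "('a \<Rightarrow> tree) \<Rightarrow> 'a list \<Rightarrow> tree" where
  "tlist e [] = Lf"
| "tlist e (x # xs) = Nd (e x) (tlist e xs)"

abbreviation "tbits \<equiv> tlist tbit"

text \<open>The last bit of the input is on top of stack 0, so the list is built from its end, every
  round prefixing a root symbol and the code of one bit. The two transfers at the end preserve the
  orientation.\<close>

definition read_input :: com where
  "read_input = Push (Suc 0) False ;;
     Loop 0 (Push (Suc 0) False ;; Push (Suc 0) False ;; Push (Suc 0) True ;; Push (Suc 0) True)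
       (Push (Suc 0) False ;; Push (Suc 0) True) ;;
     transfer (Suc 0) 2 ;; transfer 2 0"

lemma exec_read_input: "exec read_input (input (rev x)) (main (code (tbits x)))"
proof -
  let ?l = "Loop 0 (Push (Suc 0) False ;; Push (Suc 0) False ;; Push (Suc 0) True ;; Push (Suc 0) True)
       (Push (Suc 0) False ;; Push (Suc 0) True)"
  have "exec ?l (mem xs (code (tbits y)) [] [] []) (mem [] (code (tbits (rev xs @ y))) [] [] [])" for xs y
  proof (induction xs arbitrary: y)
    case (Cons b xs)
    have "exec ?l (mem (b # xs) (code (tbits y)) [] [] []) \<tau> \<longleftrightarrow>
      exec ?l (mem xs (code (tbits (b # y))) [] [] []) \<tau>" for \<tau>
      by (cases b) (simp_all add: tbit_def)
    then show ?case using Cons[of "b # y"] by simp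
  qed simp
  from this[of "rev x" "[]"] show ?thesis
    by (auto simp: read_input_def input_mem main_def)
qed

text \<open>After the root symbol of a list cell, the bit 1 takes three symbols, a node with two
  leaves, and the bit 0 takes one. The last symbol, the leaf that ends the list, is skipped.\<close>

definition write_output :: com where
  "write_output = Loop 0 (Pop 0 Skip (Pop 0 Skip Skip (Pop 0 Skip Skip (Push (Suc 0) True)))
       (Push (Suc 0) False)) Skip ;; transfer (Suc 0) 2 ;; transfer 2 0"

lemma exec_write_output: "exec write_output (main (code (tbits y))) (input (rev y))"
proof -
  let ?l = "Loop 0 (Pop 0 Skip (Pop 0 Skip Skip (Pop 0 Skip Skip (Push (Suc 0) True)))
       (Push (Suc 0) False)) Skip"
  have "exec ?l (mem (code (tbits y)) r [] [] []) (mem [] (rev y @ r) [] [] [])" for r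
  proof (induction y arbitrary: r)
    case (Cons b y)
    have "exec ?l (mem (code (tbits (b # y))) r [] [] []) \<tau> \<longleftrightarrow>
      exec ?l (mem (code (tbits y)) (b # r) [] [] []) \<tau>" for \<tau>
      by (cases b) (simp_all add: tbit_def)
    then show ?case using Cons[of "b # r"] by simp
  qed simp
  then have "exec ?l (mem (code (tbits y)) [] [] [] []) (mem [] (rev y) [] [] [])"
    by (metis append_Nil2)
  then show ?thesis by (auto simp: write_output_def input_mem main_def)
qed

theorem tm_of_comp_on:
  assumes "comp_on P g" "\<And>i. i \<in> I \<Longrightarrow> P (tbits (x i)) \<and> g (tbits (x i)) = tbits (y i)"
  shows "\<exists>M. \<forall>i\<in>I. tm_computes M (x i) (y i)"
proof -
  obtain c where c: "realizes c P g" using assms by (auto simp: comp_on_def)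
  show ?thesis
  proof (rule tm_of_com)
    show "com_ok 5 (read_input ;; c ;; write_output)"
      using c by (simp add: realizes_def read_input_def write_output_def)
    fix i assume "i \<in> I"
    then have "exec c (main (code (tbits (x i)) @ [])) (main (code (tbits (y i)) @ []))"
      using c assms(2)[of i] by (metis realizes_def)
    then show "exec (read_input ;; c ;; write_output) (input (rev (x i))) (input (rev (y i)))"
      using exec_read_input exec_write_output by auto
  qed simp
qed

section \<open>Folds over lists\<close>

lemma comp_binary:
  assumes "comp (\<lambda>x. F (left x) (right x))" "comp_on P f" "comp_on P g"
  shows "comp_on P (\<lambda>x. F (f x) (g x))"
  using comp_compose[OF assms(1) comp_Nd[OF assms(2,3)]] by simp

primrec tfold :: "(tree \<Rightarrow> tree) \<Rightarrow> tree \<Rightarrow> tree \<Rightarrow> tree" where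
  "tfold f Lf s = s"
| "tfold f (Nd a l) s = tfold f l (f (Nd a s))"

primrec tfold_ok :: "(tree \<Rightarrow> bool) \<Rightarrow> (tree \<Rightarrow> tree) \<Rightarrow> tree \<Rightarrow> tree \<Rightarrow> bool" where
  "tfold_ok P f Lf s \<longleftrightarrow> True"
| "tfold_ok P f (Nd a l) s \<longleftrightarrow> P (Nd a s) \<and> tfold_ok P f l (f (Nd a s))"

lemma comp_on_tfold:
  assumes f: "comp_on P f" and g: "comp_on Q g" "comp_on Q h"
    and ok: "\<And>x. Q x \<Longrightarrow> tfold_ok P f (g x) (h x)"
  shows "comp_on Q (\<lambda>x. tfold f (g x) (h x))"
proof -
  \<comment> \<open>The precondition of a single round: \<open>P\<close> is demanded only while an
    element is left.\<close>
  define B where "B x \<longleftrightarrow> (left x \<noteq> Lf \<longrightarrow> P (Nd (left (left x)) (right x)))" for x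
  define b where "b x = (if left x = Lf then Nd Lf (right x) else
    Nd (Nd Lf Lf) (Nd (right (left x)) (f (Nd (left (left x)) (right x)))))" for x
  have "comp_on (\<lambda>x. B x \<and> left x \<noteq> Lf) (\<lambda>x. f (Nd (left (left x)) (right x)))"
    by (rule comp_on_compose[OF _ f]) (intro comp_intros, simp add: B_def)
  then have b: "comp_on B b"
    unfolding b_def by (intro comp_intros)
  have loops: "loops B b (Nd l s) (tfold f l s)" if "tfold_ok P f l s" for l s
    using that
  proof (induction l arbitrary: s)
    case Lf
    then show ?case by (intro loops.stop) (auto simp: B_def b_def)
  next
    case (Nd a l)
    then show ?case by (auto simp: B_def b_def intro: loops.continue[where y = "Nd l (f (Nd a s))"])
  qed
  have *: "comp_on (\<lambda>x. tfold_ok P f (left x) (right x) \<and> (\<exists>l s. x = Nd l s)) (\<lambda>x. tfold f (left x) (right x))"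
    by (rule comp_loops[OF b]) (auto intro: loops)
  have "comp_on Q (\<lambda>x. (\<lambda>x. tfold f (left x) (right x)) (Nd (g x) (h x)))"
    by (rule comp_on_compose[OF _ *]) (intro comp_intros g, simp add: ok)
  then show ?thesis by simp
qed

lemma comp_tfold [comp_intros]:
  assumes "comp f" "comp_on Q g" "comp_on Q h"
  shows "comp_on Q (\<lambda>x. tfold f (g x) (h x))"
proof -
  have "tfold_ok (\<lambda>_. True) f l s" for l s by (induction l arbitrary: s) auto
  then show ?thesis using comp_on_tfold assms by blast
qed

lemma tfold_append: "tfold f (tlist e (xs @ ys)) s = tfold f (tlist e ys) (tfold f (tlist e xs) s)"
  by (induction xs arbitrary: s) auto

definition trev :: "tree \<Rightarrow> tree" where
  "trev l = tfold (\<lambda>x. x) l Lf"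

lemma comp_trev [comp_intros]: "comp_on P f \<Longrightarrow> comp_on P (\<lambda>x. trev (f x))"
  unfolding trev_def by (intro comp_intros)

lemma tfold_push: "tfold (\<lambda>x. x) (tlist e xs) (tlist e ys) = tlist e (rev xs @ ys)"
proof (induction xs arbitrary: ys)
  case (Cons x xs)
  show ?case using Cons[of "x # ys"] by simp
qed simp

lemma trev_tlist [simp]: "trev (tlist e xs) = tlist e (rev xs)"
  using tfold_push[of e xs "[]"] by (simp add: trev_def)

section \<open>A universal machine\<close>

primrec num :: "nat \<Rightarrow> tree" where
  "num 0 = Lf"
| "num (Suc n) = Nd Lf (num n)"

lemma num_eq_Lf_iff [simp]: "num n = Lf \<longleftrightarrow> n = 0"
  by (cases n) auto

lemma right_num [simp]: "right (num n) = num (n - 1)"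
  by (cases n) auto

text \<open>One unit of a subtraction: the state is \<open>Nd Lf k\<close> with \<open>k\<close> the
  remainder so far, and \<open>Lf\<close> once the subtraction has gone below zero, from where it
  does not return.\<close>

definition countdown :: "tree \<Rightarrow> tree" where
  "countdown y = (if right y = Lf then Lf else if right (right y) = Lf then Lf
     else Nd Lf (right (right (right y))))"

lemma comp_countdown: "comp countdown"
  unfolding countdown_def by (intro comp_intros)

definition num_neq :: "tree \<Rightarrow> tree \<Rightarrow> tree" where
  "num_neq m n = (if tfold countdown m (Nd Lf n) = Lf then Nd Lf Lf
     else right (tfold countdown m (Nd Lf n)))"

lemma comp_num_neq [comp_intros]:
  "comp_on P f \<Longrightarrow> comp_on P g \<Longrightarrow> comp_on P (\<lambda>x. num_neq (f x) (g x))"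
  by (rule comp_binary) (unfold num_neq_def, intro comp_intros comp_countdown)

lemma num_neq_num [simp]: "num_neq (num m) (num n) = Lf \<longleftrightarrow> m = n"
proof -
  have Lf: "tfold countdown (num m) Lf = Lf" for m
    by (induction m) (auto simp: countdown_def)
  have "tfold countdown (num m) (Nd Lf (num n)) = (if m \<le> n then Nd Lf (num (n - m)) else Lf)"
    by (induction m arbitrary: n) (auto simp: countdown_def Lf)
  then show ?thesis by (auto simp: num_neq_def)
qed

text \<open>The fields are in reverse order because the parser pushes each number onto the
  row.\<close>

fun row_tree :: "(nat \<times> nat) \<times> (nat \<times> nat \<times> move) \<Rightarrow> tree" where
  "row_tree ((q, a), (q', b, d)) = tlist num [move_code d, b, q', a, q]"

text \<open>The rows are stored in reverse order, so that a fold that keeps the last match finds the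
  first one of the machine.\<close>

definition table :: "tm \<Rightarrow> tree" where
  "table M = tlist row_tree (rev M)"

section \<open>Parsing of machine descriptions and table lookup\<close>

text \<open>The state of the parser consists of the number, the row (reversed) and the table that have
  been read so far.\<close>

definition parse_step :: "tree \<Rightarrow> tree" where
  "parse_step y =
    (if left y = Lf then
      if right (right (right (left (right (right y))))) = Lf
      then Nd Lf (Nd (Nd (left (right y)) (left (right (right y)))) (right (right (right y))))
      else Nd Lf (Nd Lf (Nd (Nd (left (right y)) (left (right (right y)))) (right (right (right y)))))
     else Nd (Nd Lf (left (right y))) (right (right y)))"

lemma comp_parse_step: "comp parse_step"
  unfolding parse_step_def by (intro comp_intros)

definition parse :: "tree \<Rightarrow> tree" where
  "parse w = right (right (tfold parse_step w (Nd Lf (Nd Lf Lf))))"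

lemma comp_parse [comp_intros]: "comp_on P f \<Longrightarrow> comp_on P (\<lambda>x. parse (f x))"
  unfolding parse_def by (intro comp_intros comp_parse_step)

text \<open>The third tail of \<open>row\<close> is nonempty once four fields have been read; the
  present number is then the fifth and completes the row.\<close>

lemma parse_unary:
  "tfold parse_step (tbits (unary k @ False # w)) (Nd (num m) (Nd row rows)) =
   tfold parse_step (tbits w) (Nd Lf
     (if right (right (right row)) = Lf then Nd (Nd (num (m + k)) row) rows
      else Nd Lf (Nd (Nd (num (m + k)) row) rows)))"
proof (induction k arbitrary: m)
  case (Suc k)
  show ?case using Suc[of "Suc m"] by (simp add: unary_def tbit_def parse_step_def)
qed (simp add: unary_def tbit_def parse_step_def)

lemma parse_row:
  "tfold parse_step (tbits (concat (map (\<lambda>n. unary n @ [False]) (row_code r)) @ w)) (Nd Lf (Nd Lf rows)) =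
   tfold parse_step (tbits w) (Nd Lf (Nd Lf (Nd (row_tree r) rows)))"
  using parse_unary[of _ _ 0]
  by (cases r rule: row_code.cases) (simp add: eval_nat_numeral)

lemma parse_description: "parse (tbits (tm_description M)) = table M"
proof -
  have "tfold parse_step (tbits (tm_description M)) (Nd Lf (Nd Lf (tlist row_tree rows))) =
    Nd Lf (Nd Lf (tlist row_tree (rev M @ rows)))" for rows
  proof (induction M arbitrary: rows)
    case (Cons r M)
    have "tm_description (r # M) =
      concat (map (\<lambda>n. unary n @ [False]) (row_code r)) @ tm_description M"
      by (simp add: tm_description_def)
    then show ?case using Cons[of "r # rows"] by (simp add: parse_row)
  qed (simp add: tm_description_def)
  from this[of "[]"] show ?thesis by (simp add: parse_def table_def)
qed

definition lookup_step :: "tree \<Rightarrow> tree" where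
  "lookup_step y =
    (if num_neq (left (right (right (right (right (left y)))))) (left (left (right y))) = Lf then
       if num_neq (left (right (right (right (left y))))) (right (left (right y))) = Lf
       then Nd (left (right y)) (left y) else right y
     else right y)"

lemma comp_lookup_step: "comp lookup_step"
  unfolding lookup_step_def by (intro comp_intros)

definition lookup :: "tree \<Rightarrow> tree \<Rightarrow> tree \<Rightarrow> tree" where
  "lookup T q a = right (tfold lookup_step T (Nd (Nd q a) Lf))"

lemma comp_lookup [comp_intros]:
  "comp_on P f \<Longrightarrow> comp_on P g \<Longrightarrow> comp_on P h \<Longrightarrow> comp_on P (\<lambda>x. lookup (f x) (g x) (h x))"
  unfolding lookup_def by (intro comp_intros comp_lookup_step)

text \<open>No row is \<open>Lf\<close>, so \<open>Lf\<close> can stand for a missing entry.\<close>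

lemma lookup_table:
  "lookup (table M) (num q) (num a) =
    (case map_of M (q, a) of None \<Rightarrow> Lf | Some r \<Rightarrow> row_tree ((q, a), r))"
proof -
  have "tfold lookup_step (table M) (Nd (Nd (num q) (num a)) Lf) = Nd (Nd (num q) (num a))
    (case map_of M (q, a) of None \<Rightarrow> Lf | Some r \<Rightarrow> row_tree ((q, a), r))"
  proof (induction M)
    case (Cons r M)
    then show ?case
      by (cases r rule: row_tree.cases) (auto simp: table_def tfold_append lookup_step_def)
  qed (simp add: table_def)
  then show ?thesis by (simp add: lookup_def)
qed

section \<open>Simulation of a machine step\<close>

fun config_tree :: "config \<Rightarrow> tree" where
  "config_tree (q, ls, rs) = Nd (num q) (Nd (tlist num ls) (tlist num rs))"

definition act_tree :: "tree \<Rightarrow> tree \<Rightarrow> tree \<Rightarrow> tree \<Rightarrow> tree" where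
  "act_tree d b ls rs =
    (if d = Lf then Nd (right ls) (Nd (left ls) (Nd b (right rs)))
     else if right d = Lf then Nd ls (Nd b (right rs))
     else Nd (Nd b ls) (right rs))"

lemma comp_act_tree [comp_intros]:
  assumes "comp_on P d" "comp_on P b" "comp_on P ls" "comp_on P rs"
  shows "comp_on P (\<lambda>x. act_tree (d x) (b x) (ls x) (rs x))"
proof -
  have "comp (\<lambda>x. act_tree (left x) (left (right x)) (left (right (right x))) (right (right (right x))))"
    unfolding act_tree_def by (intro comp_intros)
  from comp_compose[OF this, of P "\<lambda>x. Nd (d x) (Nd (b x) (Nd (ls x) (rs x)))"] show ?thesis
    using assms by (simp add: comp_intros)
qed

lemma left_tlist_num: "left (tlist num xs) = num (head_symbol xs)"
  by (cases xs) auto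

lemma right_tlist [simp]: "right (tlist e xs) = tlist e (tl xs)"
  by (cases xs) auto

lemma act_tree:
  "act_tree (num (move_code d)) (num b) (tlist num ls) (tlist num rs) =
    (case act d b ls rs of (ls', rs') \<Rightarrow> Nd (tlist num ls') (tlist num rs'))"
  by (cases d) (auto simp: act_tree_def left_tlist_num)

definition run_step :: "tree \<Rightarrow> tree" where
  "run_step y =
    (if lookup (left y) (left (right y)) (left (right (right (right y)))) = Lf then Nd Lf (right y)
     else Nd (Nd Lf Lf) (Nd (left y)
       (Nd (left (right (right (lookup (left y) (left (right y)) (left (right (right (right y))))))))
         (act_tree (left (lookup (left y) (left (right y)) (left (right (right (right y))))))
           (left (right (lookup (left y) (left (right y)) (left (right (right (right y)))))))
           (left (right (right y))) (right (right (right y)))))))"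

lemma comp_run_step: "comp run_step"
  unfolding run_step_def by (intro comp_intros)

lemma run_step:
  "run_step (Nd (table M) (config_tree c)) =
    (case tm_step M c of None \<Rightarrow> Nd Lf (config_tree c)
     | Some c' \<Rightarrow> Nd (Nd Lf Lf) (Nd (table M) (config_tree c')))"
proof -
  obtain q ls rs where c: "c = (q, ls, rs)" by (cases c)
  show ?thesis
  proof (cases "map_of M (q, head_symbol rs)")
    case None
    then show ?thesis by (simp add: run_step_def c lookup_table left_tlist_num)
  next
    case (Some r)
    obtain q' b d where "r = (q', b, d)" by (cases r)
    then show ?thesis using Some
      by (simp add: run_step_def c lookup_table left_tlist_num act_tree split: prod.split)
  qed
qed

lemma loops_run:
  "(\<lambda>c c'. tm_step M c = Some c')\<^sup>*\<^sup>* c c' \<Longrightarrow> tm_step M c' = None \<Longrightarrow>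
    loops (\<lambda>_. True) run_step (Nd (table M) (config_tree c)) (config_tree c')"
proof (induction rule: converse_rtranclp_induct)
  case base
  then show ?case by (intro loops.stop) (simp_all add: run_step)
next
  case (step c c1)
  then have "run_step (Nd (table M) (config_tree c)) = Nd (Nd Lf Lf) (Nd (table M) (config_tree c1))"
    by (simp add: run_step)
  then show ?case using step by (auto intro: loops.continue)
qed

text \<open>Prefixing a leaf turns \<open>tbit b\<close> into \<open>num (bit_symbol b)\<close>: the
  symbols 1 and 2 are the successors of 0 and 1, and \<open>tbit\<close> writes those two in
  unary.\<close>

definition initial_tree :: "tree \<Rightarrow> tree" where
  "initial_tree w = Nd Lf (Nd Lf (trev (tfold (\<lambda>y. Nd (Nd Lf (left y)) (right y)) w Lf)))"

lemma comp_initial_tree [comp_intros]: "comp_on P f \<Longrightarrow> comp_on P (\<lambda>x. initial_tree (f x))"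
  unfolding initial_tree_def by (intro comp_intros)

lemma initial_tree: "initial_tree (tbits w) = config_tree (initial_config w)"
proof -
  have "tfold (\<lambda>y. Nd (Nd Lf (left y)) (right y)) (tbits w) (tlist num xs) =
    tlist num (rev (map bit_symbol w) @ xs)" for xs
  proof (induction w arbitrary: xs)
    case (Cons b w)
    have "Nd Lf (tbit b) = num (bit_symbol b)"
      by (simp add: tbit_def bit_symbol_def eval_nat_numeral)
    then show ?case using Cons[of "bit_symbol b # xs"] by simp
  qed simp
  from this[of "[]"] show ?thesis by (simp add: initial_tree_def initial_config_def)
qed

text \<open>The accumulator is a stop flag with the bits found so far. \<open>right\<close> turns
  the symbols 1 and 2 back into bits; blanks and larger symbols set the flag.\<close>

definition output_step :: "tree \<Rightarrow> tree" where
  "output_step y =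
    (if left (right y) = Lf then
       if left y = Lf then Nd (Nd Lf Lf) (right (right y))
       else if right (right (left y)) = Lf then Nd Lf (Nd (right (left y)) (right (right y)))
       else Nd (Nd Lf Lf) (right (right y))
     else right y)"

lemma comp_output_step: "comp output_step"
  unfolding output_step_def by (intro comp_intros)

definition output_tree :: "tree \<Rightarrow> tree" where
  "output_tree c = trev (right (tfold output_step (right (right c)) (Nd Lf Lf)))"

lemma comp_output_tree [comp_intros]: "comp_on P f \<Longrightarrow> comp_on P (\<lambda>x. output_tree (f x))"
  unfolding output_tree_def by (intro comp_intros comp_output_step)

lemma output_tree: "output_tree (config_tree c) = tbits (tm_output c)"
proof -
  obtain q ls rs where c: "c = (q, ls, rs)" by (cases c)
  have stopped: "tfold output_step l (Nd (Nd Lf Lf) acc) = Nd (Nd Lf Lf) acc" for l acc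
    by (induction l) (auto simp: output_step_def)
  have "right (tfold output_step (tlist num rs) (Nd Lf (tbits acc))) =
    tbits (rev (map (\<lambda>a. a = 2) (takeWhile (\<lambda>a. a = 1 \<or> a = 2) rs)) @ acc)" for acc
  proof (induction rs arbitrary: acc)
    case (Cons a rs)
    consider "a = 0" | "a = 1" | "a = 2" | n where "a = Suc (Suc (Suc n))"
      by (metis One_nat_def Suc_1 nat.exhaust)
    then show ?case
    proof cases
      case 2
      then show ?thesis using Cons[of "False # acc"]
        by (simp add: output_step_def tbit_def)
    next
      case 3
      then show ?thesis using Cons[of "True # acc"]
        by (simp add: output_step_def tbit_def eval_nat_numeral)
    qed (simp_all add: output_step_def[of "Nd _ _"] stopped)
  qed simp
  from this[of "[]"] show ?thesis by (simp add: output_tree_def c)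
qed

section \<open>The universal function and its domain\<close>

definition univ :: "tree \<Rightarrow> tree" where
  "univ y = output_tree (iterate (\<lambda>_. True) run_step (Nd (left y) (initial_tree (right y))))"

definition univ_dom :: "tree \<Rightarrow> bool" where
  "univ_dom y \<longleftrightarrow> (\<exists>z. loops (\<lambda>_. True) run_step (Nd (left y) (initial_tree (right y))) z)"

lemma comp_univ: "comp_on univ_dom univ"
proof -
  have "comp_on univ_dom (\<lambda>y. iterate (\<lambda>_. True) run_step (Nd (left y) (initial_tree (right y))))"
    by (rule comp_on_compose[OF _ comp_iterate[OF comp_run_step]])
      (intro comp_intros, simp add: univ_dom_def)
  then show ?thesis unfolding univ_def by (rule comp_intros)
qed

theorem univ_tm:
  assumes "tm_computes M w y"
  shows "univ_dom (Nd (table M) (tbits w))" "univ (Nd (table M) (tbits w)) = tbits y"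
proof -
  obtain c where c: "(\<lambda>c c'. tm_step M c = Some c')\<^sup>*\<^sup>* (initial_config w) c"
    "tm_step M c = None" "tm_output c = y"
    using assms by (auto simp: tm_computes_def)
  then have *: "loops (\<lambda>_. True) run_step (Nd (table M) (initial_tree (tbits w))) (config_tree c)"
    by (simp add: initial_tree loops_run)
  then show "univ_dom (Nd (table M) (tbits w))" by (auto simp: univ_dom_def)
  show "univ (Nd (table M) (tbits w)) = tbits y"
    using iterate_eq[OF *] c(3) by (simp add: univ_def output_tree)
qed

section \<open>Computability of prefix sums\<close>

abbreviation "tunary n \<equiv> tbits (unary n)"

lemma tunary_simps [simp]:
  "tunary 0 = Lf" "tunary (Suc n) = Nd (Nd Lf Lf) (tunary n)"
  by (simp_all add: unary_def tbit_def)

lemma tfold_push_tunary: "tfold (\<lambda>x. x) (tunary m) (tunary n) = tunary (n + m)"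
proof (induction m arbitrary: n)
  case (Suc m)
  show ?case using Suc[of "Suc n"] by simp
qed simp

text \<open>A counter runs from \<open>n\<close> down to 0. Adding unary numbers is pushing one list
  onto the other, as all their entries are equal.\<close>

lemma computable_prefix_sum:
  assumes "computable_nat_fun h"
  shows "computable_nat_fun (\<lambda>n. \<Sum>i\<le>n. h i)"
proof -
  obtain M where M: "\<And>n. tm_computes M (unary n) (unary (h n))"
    using assms by (auto simp: computable_nat_fun_def)
  define P where "P y \<longleftrightarrow> univ_dom (Nd (table M) (left y))" for y
  define add where "add y = tfold (\<lambda>x. x) (univ (Nd (table M) (left y))) (right y)" for y
  \<comment> \<open>The round with counter 0 still adds its summand \<open>h 0\<close> before it
    stops.\<close>
  define b where "b y = (if left y = Lf then Nd Lf (add y)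
    else Nd (Nd Lf Lf) (Nd (right (left y)) (add y)))" for y
  have "comp_on P (\<lambda>y. univ (Nd (table M) (left y)))"
    by (rule comp_on_compose[OF _ comp_univ]) (intro comp_intros, simp add: P_def)
  then have "comp_on P add" unfolding add_def by (intro comp_intros)
  then have b: "comp_on P b" unfolding b_def
    by (intro comp_intros) (auto elim: comp_on_cong)
  have loops: "loops P b (Nd (tunary n) (tunary s)) (tunary (s + (\<Sum>i\<le>n. h i)))" for n s
  proof (induction n arbitrary: s)
    case 0
    show ?case using univ_tm[OF M[of 0]]
      by (intro loops.stop) (simp_all add: P_def b_def add_def tfold_push_tunary)
  next
    case (Suc n)
    have "b (Nd (tunary (Suc n)) (tunary s)) = Nd (Nd Lf Lf) (Nd (tunary n) (tunary (s + h (Suc n))))"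
      using univ_tm[OF M[of "Suc n"]] by (simp add: b_def add_def tfold_push_tunary)
    moreover have "P (Nd (tunary (Suc n)) (tunary s))"
      using univ_tm[OF M[of "Suc n"]] by (simp add: P_def)
    ultimately show ?case
      using Suc[of "s + h (Suc n)"] by (auto intro: loops.continue simp: ac_simps)
  qed
  then have "comp_on (\<lambda>x. \<exists>y. loops P b (Nd x Lf) y) (\<lambda>x. iterate P b (Nd x Lf))"
    by (intro comp_on_compose[OF _ comp_iterate[OF b]] comp_intros)
  then have "\<exists>M. \<forall>n\<in>UNIV. tm_computes M (unary n) (unary (\<Sum>i\<le>n. h i))"
    by (rule tm_of_comp_on) (use loops[of _ 0] iterate_eq in fastforce)
  then show ?thesis by (simp add: computable_nat_fun_def)
qed

section \<open>Learning algorithms\<close>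

fun example_tree :: "bits \<times> bool \<Rightarrow> tree" where
  "example_tree (x, y) = Nd (tbit y) (tbits x)"

text \<open>The modes 0, 1 and 2 stand for the expectation of a tag, of a bit of x and of the label.\<close>

definition data_step :: "tree \<Rightarrow> tree" where
  "data_step y =
    (if left (right y) = Lf then
       if left y = Lf then Nd (num 2) (right (right y)) else Nd (num 1) (right (right y))
     else if right (left (right y)) = Lf
     then Nd Lf (Nd (Nd (left y) (left (right (right y)))) (right (right (right y))))
     else Nd Lf (Nd Lf (Nd (Nd (left y) (trev (left (right (right y))))) (right (right (right y))))))"

lemma comp_data_step: "comp data_step"
  unfolding data_step_def by (intro comp_intros)

definition data_tree :: "tree \<Rightarrow> tree" where
  "data_tree w = right (right (tfold data_step w (Nd Lf (Nd Lf Lf))))"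

lemma comp_data_tree [comp_intros]: "comp_on P f \<Longrightarrow> comp_on P (\<lambda>x. data_tree (f x))"
  unfolding data_tree_def by (intro comp_intros comp_data_step)

lemma data_step_example:
  "tfold data_step (tbits (concat (map (\<lambda>b. [True, b]) x) @ False # y # w)) (Nd Lf (Nd (tbits c) acc)) =
   tfold data_step (tbits w) (Nd Lf (Nd Lf (Nd (Nd (tbit y) (tbits (rev c @ x))) acc)))"
proof (induction x arbitrary: c)
  case Nil
  show ?case by (simp add: data_step_def tbit_def[of False] eval_nat_numeral)
next
  case (Cons b x)
  have "tfold data_step (tbits (concat (map (\<lambda>b. [True, b]) (b # x)) @ False # y # w)) (Nd Lf (Nd (tbits c) acc))
    = tfold data_step (tbits (concat (map (\<lambda>b. [True, b]) x) @ False # y # w)) (Nd Lf (Nd (tbits (b # c)) acc))"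
    by (simp add: data_step_def tbit_def[of True])
  then show ?case using Cons[of "b # c"] by simp
qed

lemma data_tree_examples:
  "data_tree (tbits (concat (map example_code es))) = tlist example_tree (rev es)"
proof -
  have "tfold data_step (tbits (concat (map example_code es))) (Nd Lf (Nd Lf (tlist example_tree acc))) =
    Nd Lf (Nd Lf (tlist example_tree (rev es @ acc)))" for acc
  proof (induction es arbitrary: acc)
    case (Cons e es)
    obtain x y where e: "e = (x, y)" by (cases e)
    have "concat (map example_code (e # es)) =
      concat (map (\<lambda>b. [True, b]) x) @ False # y # concat (map example_code es)"
      by (simp add: e example_code_def)
    then show ?case
      using Cons[of "e # acc"] data_step_example[of x y _ "[]"] by (simp add: e)
  qed simp
  from this[of "[]"] show ?thesis by (simp add: data_tree_def)
qed

text \<open>The order of the examples is forgotten here, since consistency depends on their set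
  only.\<close>

lemma data_tree_dataset:
  assumes "finite D"
  shows "\<exists>es. data_tree (tbits (dataset_code D)) = tlist example_tree es \<and> set es = D"
  using data_tree_examples dataset_code_list(1)[OF assms] unfolding dataset_code_def
  by (metis set_rev)

text \<open>The accumulator is the table of the candidate machine with a flag, which becomes a node
  at the first mismatch and stays one.\<close>

definition check_step :: "tree \<Rightarrow> tree" where
  "check_step y = Nd (left (right y))
    (if left (univ (Nd (left (right y)) (right (left y)))) = Lf
     then if left (left y) = Lf then right (right y) else Nd Lf Lf
     else if left (left y) = Lf then Nd Lf Lf else right (right y))"

definition check_dom :: "tree \<Rightarrow> bool" where
  "check_dom y \<longleftrightarrow> univ_dom (Nd (left (right y)) (right (left y)))"

lemma comp_check_step: "comp_on check_dom check_step"
proof -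
  have "comp_on check_dom (\<lambda>y. univ (Nd (left (right y)) (right (left y))))"
    by (rule comp_on_compose[OF _ comp_univ]) (intro comp_intros, simp add: check_dom_def)
  then show ?thesis unfolding check_step_def by (intro comp_intros)
qed

lemma check_examples:
  assumes "tm_computes_fun M f"
  shows "tfold_ok check_dom check_step (tlist example_tree es) (Nd (table M) t)"
    and "right (tfold check_step (tlist example_tree es) (Nd (table M) t)) = Lf \<longleftrightarrow>
      t = Lf \<and> (\<forall>(x, y)\<in>set es. f x = y)"
proof -
  have M: "tm_computes M x [f x]" for x
    using assms by (simp add: tm_computes_fun_def)
  have check: "check_step (Nd (example_tree (x, y)) (Nd (table M) t)) =
      Nd (table M) (if f x = y then t else Nd Lf Lf)" for x y t
    using univ_tm(2)[OF M[of x]] by (simp add: check_step_def tbit_def)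
  have dom: "check_dom (Nd (example_tree (x, y)) (Nd (table M) t))" for x y t
    using univ_tm(1)[OF M[of x]] by (simp add: check_dom_def)
  show "tfold_ok check_dom check_step (tlist example_tree es) (Nd (table M) t)"
  proof (induction es arbitrary: t)
    case (Cons e es)
    obtain x y where e: "e = (x, y)" by (cases e)
    show ?case by (simp add: e check dom Cons del: example_tree.simps)
  qed simp
  show "right (tfold check_step (tlist example_tree es) (Nd (table M) t)) = Lf \<longleftrightarrow>
      t = Lf \<and> (\<forall>(x, y)\<in>set es. f x = y)"
  proof (induction es arbitrary: t)
    case (Cons e es)
    obtain x y where e: "e = (x, y)" by (cases e)
    show ?case by (simp add: e check Cons del: example_tree.simps)
  qed simp
qed

definition rejects :: "tm \<Rightarrow> tree \<Rightarrow> tree" where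
  "rejects R y = right (tfold check_step (left y) (Nd (parse (univ (Nd (table R) (right y)))) Lf))"

definition rejects_dom :: "tree \<Rightarrow> bool" where
  "rejects_dom y \<longleftrightarrow> (\<exists>es p. y = Nd (tlist example_tree es) (tbits p))"

lemma decode_computes:
  assumes "encoding_system R"
  obtains M where "tm_computes R p (tm_description M)" "tm_computes_fun M (decode R p)"
  using decode_eq_iff[OF assms, of p "decode R p"] by (auto simp: encodes_def)

text \<open>Both simulations halt: an encoding system halts on every string, and the machines it
  describes are total.\<close>

lemma comp_rejects:
  assumes R: "encoding_system R"
  shows "comp_on rejects_dom (rejects R)"
proof -
  have "comp_on rejects_dom (\<lambda>y. univ (Nd (table R) (right y)))"
  proof (rule comp_on_compose[OF _ comp_univ])
    show "univ_dom (Nd (table R) (right y))" if y: "rejects_dom y" for y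
    proof -
      obtain es p where "y = Nd (tlist example_tree es) (tbits p)"
        using y by (auto simp: rejects_dom_def)
      moreover obtain M where "tm_computes R p (tm_description M)" using decode_computes[OF R] .
      ultimately show ?thesis using univ_tm(1) by simp
    qed
  qed (intro comp_intros)
  then have 1: "comp_on rejects_dom (\<lambda>y. Nd (parse (univ (Nd (table R) (right y)))) Lf)"
    by (intro comp_intros)
  have "comp_on rejects_dom (\<lambda>y. tfold check_step (left y) (Nd (parse (univ (Nd (table R) (right y)))) Lf))"
  proof (rule comp_on_tfold[OF comp_check_step _ 1])
    fix y assume "rejects_dom y"
    then obtain es p where y: "y = Nd (tlist example_tree es) (tbits p)" by (auto simp: rejects_dom_def)
    obtain M where M: "tm_computes R p (tm_description M)" "tm_computes_fun M (decode R p)"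
      using decode_computes[OF R] .
    then show "tfold_ok check_dom check_step (left y) (Nd (parse (univ (Nd (table R) (right y)))) Lf)"
      using check_examples(1)[OF M(2)] univ_tm(2)[OF M(1)] by (simp add: y parse_description)
  qed (intro comp_intros)
  then show ?thesis unfolding rejects_def by (rule comp_right)
qed

lemma rejects_iff:
  assumes R: "encoding_system R"
  shows "rejects R (Nd (tlist example_tree es) (tbits p)) = Lf \<longleftrightarrow> consistent R p (set es)"
proof -
  obtain M where M: "tm_computes R p (tm_description M)" "tm_computes_fun M (decode R p)"
    using decode_computes[OF R] .
  then show ?thesis
    using check_examples(2)[OF M(2), of es Lf] univ_tm(2)[OF M(1)]
    by (simp add: rejects_def parse_description consistent_def)
qed

text \<open>Training data of a function in the class are fitted by every string that encodes the
  function, so \<open>g\<close> only has to succeed on data with a consistent string.\<close>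

lemma learning_algorithm_of_comp_on:
  assumes "comp_on P g"
    and "\<And>es. \<exists>p. consistent R p (set es) \<Longrightarrow>
      P (tlist example_tree es) \<and> g (tlist example_tree es) = tbits (A (set es))"
  shows "learning_algorithm R A"
proof -
  have "comp_on (\<lambda>w. P (data_tree w)) (\<lambda>w. g (data_tree w))"
    by (rule comp_on_compose[OF _ assms(1)]) (intro comp_intros)
  then have "\<exists>M. \<forall>(N, f)\<in>UNIV \<times> fun_class R.
    tm_computes M (dataset_code (training_data N f)) (A (training_data N f))"
    unfolding case_prod_beta
  proof (rule tm_of_comp_on)
    fix i :: "nat \<times> (bits \<Rightarrow> bool)" assume "i \<in> UNIV \<times> fun_class R"
    then obtain N p where i: "i = (N, decode R p)" by (auto simp: fun_class_def)
    obtain es where es: "data_tree (tbits (dataset_code (training_data N (decode R p)))) =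
        tlist example_tree es" "set es = training_data N (decode R p)"
      using data_tree_dataset[OF finite_training_data] by blast
    have "consistent R p (set es)" by (auto simp: es consistent_def training_data_def)
    then show "P (data_tree (tbits (dataset_code (training_data (fst i) (snd i))))) \<and>
        g (data_tree (tbits (dataset_code (training_data (fst i) (snd i))))) =
        tbits (A (training_data (fst i) (snd i)))"
      using assms(2)[of es] es i by auto
  qed
  then show ?thesis by (auto simp: learning_algorithm_def)
qed

theorem learning_algorithm_mci_enum:
  assumes R: "encoding_system R" and E: "assumption_E C E"
  shows "learning_algorithm R (mci_enum R E)"
proof -
  obtain M where M: "\<And>i. tm_computes M (unary i) (E i)"
    using E by (auto simp: assumption_E_def)
  have surj: "range E = UNIV" using E by (simp add: assumption_E_def)
  define P where "P y \<longleftrightarrow> (\<exists>es n. y = Nd (tlist example_tree es) (tunary n))" for y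
  define cand where "cand y = univ (Nd (table M) (right y))" for y
  define b where "b y = (if rejects R (Nd (left y) (cand y)) = Lf then Nd Lf (cand y)
    else Nd (Nd Lf Lf) (Nd (left y) (Nd (Nd Lf Lf) (right y))))" for y
  have cand: "cand (Nd t (tunary n)) = tbits (E n)" for t n
    using univ_tm(2)[OF M] by (simp add: cand_def)
  have comp_cand: "comp_on P cand"
    unfolding cand_def
  proof (rule comp_on_compose[OF _ comp_univ])
    show "univ_dom (Nd (table M) (right y))" if "P y" for y
      using that univ_tm(1)[OF M] by (auto simp: P_def)
  qed (intro comp_intros)
  have "comp_on P (\<lambda>y. rejects R (Nd (left y) (cand y)))"
  proof (rule comp_on_compose[OF _ comp_rejects[OF R]])
    show "rejects_dom (Nd (left y) (cand y))" if "P y" for y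
      using that cand by (auto simp: P_def rejects_dom_def)
  qed (intro comp_intros comp_cand)
  moreover have "comp_on (\<lambda>y. P y \<and> Q y) cand" for Q
    using comp_cand by (rule comp_on_cong) simp
  ultimately have b: "comp_on P b"
    unfolding b_def by (intro comp_intros)
  have loops: "loops P b (Nd (tlist example_tree es) Lf) (tbits (mci_enum R E (set es)))"
    if "\<exists>p. consistent R p (set es)" for es
  proof -
    define m where "m = (LEAST i. consistent R (E i) (set es))"
    \<comment> \<open>Surjectivity of \<open>E\<close> is what makes the search end.\<close>
    have "\<exists>i. consistent R (E i) (set es)" using that surj by (metis surjD)
    then have m: "consistent R (E m) (set es)" unfolding m_def by (rule LeastI_ex)
    have less: "\<not> consistent R (E n) (set es)" if "n < m" for n
      using that not_less_Least unfolding m_def by blast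
    have P: "P (Nd (tlist example_tree es) (tunary n))" for n
      by (auto simp: P_def)
    have "loops P b (Nd (tlist example_tree es) (tunary 0)) (tbits (E m))"
    \<comment> \<open>Induction downwards from \<open>m\<close>, since a \<open>loops\<close>
      derivation is built from its last round.\<close>
    proof (rule inc_induct[of 0 m])
      show "loops P b (Nd (tlist example_tree es) (tunary m)) (tbits (E m))"
        using m by (intro loops.stop P) (simp add: b_def cand rejects_iff[OF R])
    next
      fix n assume "n < m" and IH: "loops P b (Nd (tlist example_tree es) (tunary (Suc n))) (tbits (E m))"
      then have "b (Nd (tlist example_tree es) (tunary n)) =
          Nd (Nd Lf Lf) (Nd (tlist example_tree es) (tunary (Suc n)))"
        using less by (simp add: b_def cand rejects_iff[OF R])
      then show "loops P b (Nd (tlist example_tree es) (tunary n)) (tbits (E m))"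
        using IH P by (blast intro: loops.continue)
    qed simp
    then show ?thesis by (simp add: mci_enum_def m_def)
  qed
  have "comp_on (\<lambda>x. \<exists>y. loops P b (Nd x Lf) y) (\<lambda>x. iterate P b (Nd x Lf))"
    by (intro comp_on_compose[OF _ comp_iterate[OF b]] comp_intros)
  then show ?thesis
    by (rule learning_algorithm_of_comp_on) (use loops iterate_eq in blast)
qed

definition select :: "tm \<Rightarrow> bits list \<Rightarrow> dataset \<Rightarrow> bits" where
  "select R ps D = (case find (\<lambda>p. consistent R p D) ps of None \<Rightarrow> [] | Some p \<Rightarrow> p)"

text \<open>The list is hard-wired: induction on \<open>ps\<close> yields a nested conditional in
  which no complexity is ever evaluated.\<close>

lemma learning_algorithm_select:
  assumes R: "encoding_system R"
  shows "learning_algorithm R (select R ps)"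
proof -
  let ?P = "\<lambda>z. \<exists>es. z = tlist example_tree es"
  have "\<exists>g. comp_on ?P g \<and> (\<forall>es. g (tlist example_tree es) = tbits (select R ps (set es)))"
  proof (induction ps)
    case Nil
    then show ?case by (intro exI[of _ "\<lambda>_. Lf"]) (auto simp: select_def intro: comp_const)
  next
    case (Cons p ps)
    then obtain g where g: "comp_on ?P g"
      "\<And>es. g (tlist example_tree es) = tbits (select R ps (set es))" by blast
    define g' where "g' z = (if rejects R (Nd z (tbits p)) = Lf then tbits p else g z)" for z
    have "comp_on ?P (\<lambda>z. rejects R (Nd z (tbits p)))"
    proof (rule comp_on_compose[OF _ comp_rejects[OF R]])
      show "rejects_dom (Nd z (tbits p))" if "?P z" for z
        using that by (auto simp: rejects_dom_def)
    qed (intro comp_intros)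
    moreover have "comp_on (\<lambda>z. ?P z \<and> Q z) g" for Q
      using g(1) by (rule comp_on_cong) simp
    ultimately have "comp_on ?P g'"
      unfolding g'_def by (intro comp_intros)
    moreover have "g' (tlist example_tree es) = tbits (select R (p # ps) (set es))" for es
      by (simp add: g'_def select_def rejects_iff[OF R] g(2)[unfolded select_def])
    ultimately show ?case by blast
  qed
  then obtain g where "comp_on ?P g"
    "\<And>es. g (tlist example_tree es) = tbits (select R ps (set es))" by blast
  then show ?thesis by (intro learning_algorithm_of_comp_on) auto
qed

section \<open>Length complexity\<close>

text \<open>The infimum of a nonempty set is attained because the order is a well-order; that of the
  empty set is infinite and has no finite bound.\<close>

lemma Inf_enat_image_le_iff: "Inf (enat ` S) \<le> enat n \<longleftrightarrow> (\<exists>m\<in>S. m \<le> n)"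
proof
  assume le: "Inf (enat ` S) \<le> enat n"
  then have "S \<noteq> {}" by (auto simp: top_enat_def)
  then obtain k where "enat k \<in> enat ` S" by blast
  then have "Inf (enat ` S) \<in> enat ` S" by (rule wellorder_InfI)
  then show "\<exists>m\<in>S. m \<le> n" using le by auto
next
  assume "\<exists>m\<in>S. m \<le> n"
  then obtain m where "m \<in> S" "m \<le> n" by blast
  then show "Inf (enat ` S) \<le> enat n" by (meson INF_lower2 enat_ord_simps(1))
qed

text \<open>For infinite \<open>b\<close> there is nothing to show. This form fits the
  characterisations below, which describe length complexities by their finite bounds.\<close>

lemma enat_leI:
  fixes a b :: enat
  shows "(\<And>n. b \<le> enat n \<Longrightarrow> a \<le> enat n) \<Longrightarrow> a \<le> b"
  by (cases b) auto

lemma alg_length_complexity_le_iff: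
  "alg_length_complexity_le R C A c \<le> enat n \<longleftrightarrow>
    (\<forall>f\<in>fun_class_le R C c. \<forall>m\<ge>n. decode R (A (training_data m f)) = f)"
  unfolding alg_length_complexity_le_def SUP_le_iff alg_length_complexity_def Inf_enat_image_le_iff
  by (fastforce intro: order_trans)

text \<open>Separation at length \<open>m\<close> implies separation at every larger length, so the
  infimum can be tested at \<open>n\<close> itself.\<close>

lemma class_length_complexity_le_iff:
  "class_length_complexity F \<le> enat n \<longleftrightarrow>
    (\<forall>f\<in>F. \<forall>f'\<in>F. (\<forall>x. length x \<le> n \<longrightarrow> f x = f' x) \<longrightarrow> f = f')"
  (is "_ \<longleftrightarrow> ?R n")
proof -
  have "?R n" if "?R m" "m \<le> n" for m
    using that order_trans[of _ m n] by blast
  moreover have "{n. \<forall>f\<in>F. \<forall>f'\<in>F. f \<noteq> f' \<longrightarrow> (\<exists>x. length x \<le> n \<and> f x \<noteq> f' x)} = {n. ?R n}"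
    by blast
  ultimately show ?thesis
    unfolding class_length_complexity_def Inf_enat_image_le_iff by auto
qed

lemma complexity_attained:
  assumes "f \<in> fun_class R"
  shows "\<exists>p. decode R p = f \<and> C p = complexity R C f"
proof -
  have "complexity R C f \<in> {C p |p. decode R p = f}"
    unfolding complexity_def by (rule Inf_nat_def1) (use assms in \<open>auto simp: fun_class_def\<close>)
  then show ?thesis by auto
qed

lemma decode_in_fun_class_le: "C p \<le> c \<Longrightarrow> decode R p \<in> fun_class_le R C c"
  unfolding fun_class_le_def fun_class_def complexity_def
  by (auto intro!: order_trans[OF cInf_lower])

lemma consistent_training_data:
  "consistent R p (training_data n f) \<longleftrightarrow> (\<forall>x. length x \<le> n \<longrightarrow> decode R p x = f x)"
  by (auto simp: consistent_def training_data_def)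

lemma class_le_alg_length_complexity:
  "class_length_complexity (fun_class_le R C c) \<le> alg_length_complexity_le R C A c"
proof (rule enat_leI)
  fix n assume n: "alg_length_complexity_le R C A c \<le> enat n"
  show "class_length_complexity (fun_class_le R C c) \<le> enat n"
    unfolding class_length_complexity_le_iff
  proof (intro ballI impI)
    fix f f' assume f: "f \<in> fun_class_le R C c" "f' \<in> fun_class_le R C c"
      and "\<forall>x. length x \<le> n \<longrightarrow> f x = f' x"
    then have "training_data n f = training_data n f'" by (auto simp: training_data_def)
    then show "f = f'" using n f by (metis alg_length_complexity_le_iff order_refl)
  qed
qed

lemma mci_length_complexity:
  assumes "is_mci R C A"
  shows "alg_length_complexity_le R C A c = class_length_complexity (fun_class_le R C c)"
proof (rule antisym[OF enat_leI class_le_alg_length_complexity])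
  fix n assume n: "class_length_complexity (fun_class_le R C c) \<le> enat n"
  show "alg_length_complexity_le R C A c \<le> enat n"
    unfolding alg_length_complexity_le_iff
  proof (intro ballI allI impI)
    fix f m assume f: "f \<in> fun_class_le R C c" and "n \<le> m"
    let ?D = "training_data m f"
    obtain p where p: "decode R p = f" "C p \<le> c"
      using complexity_attained[of f R C] f by (auto simp: fun_class_le_def)
    then have "consistent R p ?D" by (simp add: consistent_training_data)
    then have "is_arg_min C (\<lambda>p. consistent R p ?D) (A ?D)"
      using assms finite_training_data unfolding is_mci_def by blast
    then have A: "consistent R (A ?D) ?D" "C (A ?D) \<le> C p"
      using \<open>consistent R p ?D\<close> by (auto simp: is_arg_min_linorder)
    then have "decode R (A ?D) \<in> fun_class_le R C c"
      using p by (intro decode_in_fun_class_le) simp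
    moreover have "decode R (A ?D) x = f x" if "length x \<le> n" for x
      using A(1) that \<open>n \<le> m\<close> by (simp add: consistent_training_data)
    ultimately show "decode R (A ?D) = f"
      using n f unfolding class_length_complexity_le_iff by blast
  qed
qed

lemma ex_optimal_learning_algorithm:
  assumes R: "encoding_system R"
  shows "\<exists>A. learning_algorithm R A \<and>
    alg_length_complexity_le R C A c = class_length_complexity (fun_class_le R C c)"
proof (cases "class_length_complexity (fun_class_le R C c)")
  case infinity
  \<comment> \<open>By the general lower bound every algorithm has the value infinity here.\<close>
  then show ?thesis
    using learning_algorithm_select[OF R] class_le_alg_length_complexity
    by (metis enat_ord_simps(5))
next
  case (enat n)
  let ?F = "fun_class_le R C c"
  have sep: "f = f'" if "f \<in> ?F" "f' \<in> ?F" "\<And>x. length x \<le> n \<Longrightarrow> f x = f' x" for f f'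
    using class_length_complexity_le_iff[of ?F n] enat that by auto
  \<comment> \<open>A function in the class is determined by its values on the finitely many strings
    of length at most \<open>n\<close>, so the class is finite.\<close>
  have "inj_on (\<lambda>f. {x. length x \<le> n \<and> f x}) ?F"
    by (intro inj_onI sep) auto
  moreover have "finite {x :: bits. length x \<le> n}"
    using finite_lists_length_le[of "UNIV :: bool set" n] by simp
  then have "finite ((\<lambda>f. {x. length x \<le> n \<and> f x}) ` ?F)"
    by (auto intro: finite_subset[of _ "Pow {x. length x \<le> n}"])
  ultimately have "finite ?F" by (rule finite_imageD[rotated])
  moreover have "\<exists>p. decode R p = f" if "f \<in> ?F" for f
    using that by (auto simp: fun_class_le_def fun_class_def)
  ultimately obtain P where P: "finite P" "decode R ` P = ?F"
    by (metis finite_subset_image image_iff rangeI subset_iff fun_class_def)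
  then obtain ps where ps: "decode R ` set ps = ?F" using finite_list by metis
  have "alg_length_complexity_le R C (select R ps) c \<le> enat n"
    unfolding alg_length_complexity_le_iff
  proof (intro ballI allI impI)
    fix f m assume f: "f \<in> ?F" and "n \<le> m"
    let ?D = "training_data m f"
    obtain p where "p \<in> set ps" "decode R p = f" using f ps by (metis imageE)
    then have "\<exists>p\<in>set ps. consistent R p ?D"
      by (auto simp: consistent_training_data)
    then obtain q where q: "find (\<lambda>p. consistent R p ?D) ps = Some q"
      by (metis find_None_iff option.exhaust)
    then have "consistent R q ?D" "q \<in> set ps" by (auto simp: find_Some_iff)
    then have "decode R q = f"
      using f ps \<open>n \<le> m\<close> by (intro sep) (auto simp: consistent_training_data)
    then show "decode R (select R ps ?D) = f" by (simp add: select_def q)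
  qed
  then show ?thesis
    using learning_algorithm_select[OF R] class_le_alg_length_complexity enat
    by (metis antisym)
qed

section \<open>The three equivalent statements\<close>

lemma length_generalization_imp_computably_bounded:
  assumes "length_generalization R C"
  shows "computably_bounded (\<lambda>c. class_length_complexity (fun_class_le R C c))"
proof -
  obtain A Nhat where Nhat: "computable_nat_fun Nhat"
    "\<And>f N'. f \<in> fun_class R \<Longrightarrow> N' \<ge> Nhat (complexity R C f) \<Longrightarrow>
       decode R (A (training_data N' f)) = f"
    using assms by (auto simp: length_generalization_def length_generalization_via_def)
  have "alg_length_complexity_le R C A c \<le> enat (\<Sum>i\<le>c. Nhat i)" for c
    unfolding alg_length_complexity_le_iff
  proof (intro ballI allI impI)
    fix f m assume f: "f \<in> fun_class_le R C c" and m: "(\<Sum>i\<le>c. Nhat i) \<le> m"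
    then have "Nhat (complexity R C f) \<le> (\<Sum>i\<le>c. Nhat i)"
      by (intro member_le_sum) (auto simp: fun_class_le_def)
    then show "decode R (A (training_data m f)) = f"
      using f m by (intro Nhat(2)) (auto simp: fun_class_le_def)
  qed
  then show ?thesis
    using computable_prefix_sum[OF Nhat(1)] class_le_alg_length_complexity order_trans
    unfolding computably_bounded_def by meson
qed

text \<open>The bound \<open>h\<close> itself serves as the rate: every \<open>f\<close> lies in the
  class of level \<open>complexity R C f\<close>, on which the interpolator attains the length
  complexity of the class.\<close>

lemma computably_bounded_imp_via_mci:
  assumes "is_mci R C A" "learning_algorithm R A"
    and "computably_bounded (\<lambda>c. class_length_complexity (fun_class_le R C c))"
  shows "length_generalization_via R C A"
proof -
  obtain h where h: "computable_nat_fun h"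
    "\<And>c. class_length_complexity (fun_class_le R C c) \<le> enat (h c)"
    using assms(3) by (auto simp: computably_bounded_def)
  have "decode R (A (training_data N f)) = f"
    if "f \<in> fun_class R" "h (complexity R C f) \<le> N" for f N
  proof -
    have "f \<in> fun_class_le R C (complexity R C f)" using that by (simp add: fun_class_le_def)
    then show ?thesis
      using h(2) that(2) mci_length_complexity[OF assms(1)] alg_length_complexity_le_iff by metis
  qed
  then show ?thesis
    using assms(2) h(1) by (auto simp: length_generalization_via_def)
qed

text \<open>The minimum over learning algorithms appears as an attained lower bound, apart from the
  value of the interpolator, which need not be computable for an arbitrary \<open>C\<close>.\<close>

theorem theorem4p2:
  fixes R :: tm and C :: "bits \<Rightarrow> nat"
  assumes "encoding_system R"
  shows "(\<forall>c.
            (\<forall>A_mci. is_mci R C A_mci \<longrightarrow>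
               alg_length_complexity_le R C A_mci c = class_length_complexity (fun_class_le R C c)) \<and>
            (\<exists>A. learning_algorithm R A \<and>
               alg_length_complexity_le R C A c = class_length_complexity (fun_class_le R C c)) \<and>
            (\<forall>A. learning_algorithm R A \<longrightarrow>
               class_length_complexity (fun_class_le R C c) \<le> alg_length_complexity_le R C A c))
       \<and> (\<forall>E. assumption_E C E \<longrightarrow>
            (length_generalization R C \<longleftrightarrow> length_generalization_via R C (mci_enum R E)) \<and>
            (length_generalization_via R C (mci_enum R E) \<longleftrightarrow>
               computably_bounded (\<lambda>c. class_length_complexity (fun_class_le R C c))) \<and>
            (\<forall>A_mci. is_mci R C A_mci \<and> learning_algorithm R A_mci \<longrightarrow>
               (length_generalization R C \<longleftrightarrow> length_generalization_via R C A_mci) \<and>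
               (length_generalization_via R C A_mci \<longleftrightarrow>
                  computably_bounded (\<lambda>c. class_length_complexity (fun_class_le R C c)))))"
proof -
  let ?bounded = "computably_bounded (\<lambda>c. class_length_complexity (fun_class_le R C c))"
  \<comment> \<open>The implications form a cycle: a computable bound gives generalization via
    \<open>A\<close>, this gives generalization via some algorithm, and any such algorithm gives a
    computable bound.\<close>
  have equiv: "(length_generalization R C \<longleftrightarrow> length_generalization_via R C A) \<and>
      (length_generalization_via R C A \<longleftrightarrow> ?bounded)"
    if "is_mci R C A" "learning_algorithm R A" for A
    using computably_bounded_imp_via_mci[OF that] length_generalization_imp_computably_bounded
    unfolding length_generalization_def by blast
  show ?thesis
    using mci_length_complexity ex_optimal_learning_algorithm[OF assms]
      class_le_alg_length_complexity equiv
      equiv[OF mci_enum_is_mci learning_algorithm_mci_enum[OF assms]]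
    by blast
qed

end
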